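(* The sesqui-linear forms $\mathfrak t$ and $\mathfrak t_G$ are different: $\mathfrak t$ is not the restriction of $\mathfrak t_G$ to $\mathfrak D\times\mathfrak D$ (indeed $\mathfrak t_G$ is bounded whereas $\mathfrak t$ is not).
   Context: Work in $L^2(\mathbb{R})$ with $(f,g)=\int\overline{f}g\,dx$; $q$ is multiplication by $x$, $p=-i\,d/dx$, $t=q^{-1}p$ with $D(t)=\{f\in D(p):pf\in D(q^{-1})\}$, $t^*$ its adjoint; $L^2_0$, $L^2_1$ the even/odd subspaces. Define $S$ in $L^2_0$ by $D(S)=\{f\in L^2_0\cap\bigcap_nD(t^{2n+1}):\sum_{n=0}^N\frac{(-1)^n}{2n+1}t^{2n+1}f$ converges in norm$\}$, $Sf=-\sum_{n\ge0}\frac{(-1)^n}{2n+1}t^{2n+1}f$, and $S^*$ (notation only) in $L^2_1$ by the same formulas with $t^*$ and $L^2_1$. Let $\mathfrak D=D(S)\oplus D(S^* )$ and $\mathfrak t[\psi_0\oplus\psi_1,\phi_0\oplus\phi_1]=\frac12((\psi_0,S\phi_0)+(S\psi_0,\phi_0))+\frac12((\psi_1,S^*\phi_1)+(S^*\psi_1,\phi_1))$ on $\mathfrak D\times\mathfrak D$. Let $h=\frac12(p^2+q^2)$ and $e_n$ ($n\ge0$) its normalized eigenvectors, $he_n=(n+\frac12)e_n$, namely $e_n=c_nH_n(x)e^{-x^2/2}$ with $H_n$ the Hermite polynomials and $c_n>0$. For $t\in[0,2\pi]$ and $N\ge0$ let $\varphi^{(N)}_t=\sum_{n=0}^Ne^{-ith}e_n$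 and $P^{(N)}_t=\frac1{2\pi}(\varphi_t^{(N)},\cdot)\varphi^{(N)}_t$. For all $f,g\in L^2(\mathbb R)$ the limit $\lim_{N\to\infty}\int_0^{2\pi}t\,(f,P^{(N)}_tg)\,dt$ exists and equals $(f,T_Gg)$ for a unique bounded self-adjoint operator $T_G$. Define $\mathfrak t_G[\phi,\psi]=\frac12((\phi,T_G\psi)+(T_G\phi,\psi))$ on $L^2(\mathbb R)\times L^2(\mathbb R)$. *)

theory Defs
  imports "HOL-Analysis.Analysis"
begin

text \<open>Elements of L^2(R) are represented by (representatives) f :: real => complex;
  all operators are encoded as relations that only depend on a.e.-classes.\<close>

definition L2 :: "(real \<Rightarrow> complex) set" where
  "L2 = {f. f \<in> borel_measurable lborel \<and> integrable lborel (\<lambda>x. (norm (f x))^2)}"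

definition ip :: "(real \<Rightarrow> complex) \<Rightarrow> (real \<Rightarrow> complex) \<Rightarrow> complex" where
  "ip f g = (LINT x|lborel. cnj (f x) * g x)"

definition l2norm :: "(real \<Rightarrow> complex) \<Rightarrow> real" where
  "l2norm f = sqrt (LINT x|lborel. (norm (f x))^2)"

definition L2_even :: "(real \<Rightarrow> complex) set" where
  "L2_even = {f \<in> L2. AE x in lborel. f (- x) = f x}"

definition L2_odd :: "(real \<Rightarrow> complex) set" where
  "L2_odd = {f \<in> L2. AE x in lborel. f (- x) = - f x}"

definition even_part :: "(real \<Rightarrow> complex) \<Rightarrow> real \<Rightarrow> complex" where
  "even_part f = (\<lambda>x. (f x + f (- x)) / 2)"

definition odd_part :: "(real \<Rightarrow> complex) \<Rightarrow> real \<Rightarrow> complex" where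
  "odd_part f = (\<lambda>x. (f x - f (- x)) / 2)"

text \<open>p = -i d/dx on its natural (self-adjoint) domain: f is a.e. equal to an absolutely
  continuous function whose derivative i g lies in L^2; then p f = g.\<close>
definition p_rel :: "(real \<Rightarrow> complex) \<Rightarrow> (real \<Rightarrow> complex) \<Rightarrow> bool" where
  "p_rel f g \<longleftrightarrow> f \<in> L2 \<and> g \<in> L2 \<and>
     (\<exists>c. AE x in lborel. f x = c + \<i> * interval_lebesgue_integral lborel 0 (ereal x) g)"

definition qinv_rel :: "(real \<Rightarrow> complex) \<Rightarrow> (real \<Rightarrow> complex) \<Rightarrow> bool" where
  "qinv_rel g h \<longleftrightarrow> g \<in> L2 \<and> h \<in> L2 \<and> (AE x in lborel. h x = g x / complex_of_real x)"

definition t_rel :: "(real \<Rightarrow> complex) \<Rightarrow> (real \<Rightarrow> complex) \<Rightarrow> bool" where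
  "t_rel f h \<longleftrightarrow> (\<exists>g. p_rel f g \<and> qinv_rel g h)"

definition tadj_rel :: "(real \<Rightarrow> complex) \<Rightarrow> (real \<Rightarrow> complex) \<Rightarrow> bool" where
  "tadj_rel g h \<longleftrightarrow> g \<in> L2 \<and> h \<in> L2 \<and> (\<forall>f k. t_rel f k \<longrightarrow> ip g k = ip h f)"

primrec pow_rel :: "((real \<Rightarrow> complex) \<Rightarrow> (real \<Rightarrow> complex) \<Rightarrow> bool) \<Rightarrow> nat
    \<Rightarrow> (real \<Rightarrow> complex) \<Rightarrow> (real \<Rightarrow> complex) \<Rightarrow> bool" where
  "pow_rel R 0 f g \<longleftrightarrow> f \<in> L2 \<and> g \<in> L2 \<and> (AE x in lborel. g x = f x)"
| "pow_rel R (Suc n) f h \<longleftrightarrow> (\<exists>g. R f g \<and> pow_rel R n g h)"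

definition S_gen_rel :: "((real \<Rightarrow> complex) \<Rightarrow> (real \<Rightarrow> complex) \<Rightarrow> bool) \<Rightarrow> (real \<Rightarrow> complex) set
    \<Rightarrow> (real \<Rightarrow> complex) \<Rightarrow> (real \<Rightarrow> complex) \<Rightarrow> bool" where
  "S_gen_rel R V f g \<longleftrightarrow> f \<in> V \<and> g \<in> L2 \<and>
     (\<exists>u. (\<forall>n. pow_rel R (2 * n + 1) f (u n)) \<and>
          (\<lambda>N. l2norm (\<lambda>x. (\<Sum>n\<le>N. complex_of_real ((-1)^n / real (2 * n + 1)) * u n x) + g x))
            \<longlonglongrightarrow> 0)"

definition S_rel where "S_rel = S_gen_rel t_rel L2_even"
definition Sstar_rel where "Sstar_rel = S_gen_rel tadj_rel L2_odd"

definition S_dom :: "(real \<Rightarrow> complex) set" where "S_dom = {f. \<exists>g. S_rel f g}"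
definition Sstar_dom :: "(real \<Rightarrow> complex) set" where "Sstar_dom = {f. \<exists>g. Sstar_rel f g}"

definition S_app :: "(real \<Rightarrow> complex) \<Rightarrow> real \<Rightarrow> complex" where "S_app f = (SOME g. S_rel f g)"
definition Sstar_app :: "(real \<Rightarrow> complex) \<Rightarrow> real \<Rightarrow> complex" where "Sstar_app f = (SOME g. Sstar_rel f g)"

definition form_dom :: "(real \<Rightarrow> complex) set" where
  "form_dom = {\<psi> \<in> L2. even_part \<psi> \<in> S_dom \<and> odd_part \<psi> \<in> Sstar_dom}"

definition t_form :: "(real \<Rightarrow> complex) \<Rightarrow> (real \<Rightarrow> complex) \<Rightarrow> complex" where
  "t_form \<psi> \<phi> =
     (ip (even_part \<psi>) (S_app (even_part \<phi>)) + ip (S_app (even_part \<psi>)) (even_part \<phi>)) / 2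
   + (ip (odd_part \<psi>) (Sstar_app (odd_part \<phi>)) + ip (Sstar_app (odd_part \<psi>)) (odd_part \<phi>)) / 2"

text \<open>Physicists' Hermite polynomials and the normalized harmonic oscillator eigenvectors.\<close>
fun hermite :: "nat \<Rightarrow> real \<Rightarrow> real" where
  "hermite 0 x = 1"
| "hermite (Suc 0) x = 2 * x"
| "hermite (Suc (Suc n)) x = 2 * x * hermite (Suc n) x - 2 * real (Suc n) * hermite n x"

definition herm_c :: "nat \<Rightarrow> real" where
  "herm_c n = 1 / sqrt (LINT x|lborel. (hermite n x * exp (- (x^2) / 2))^2)"

definition e_fun :: "nat \<Rightarrow> real \<Rightarrow> complex" where
  "e_fun n = (\<lambda>x. complex_of_real (herm_c n * hermite n x * exp (- (x^2) / 2)))"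

text \<open>phi_t^(N) = sum_{n<=N} e^{-ith} e_n = sum_{n<=N} e^{-it(n+1/2)} e_n.\<close>
definition phi_t :: "real \<Rightarrow> nat \<Rightarrow> real \<Rightarrow> complex" where
  "phi_t t N = (\<lambda>x. \<Sum>n\<le>N. exp (- \<i> * complex_of_real (t * (real n + 1/2))) * e_fun n x)"

text \<open>int_0^{2 pi} t (f, P_t^(N) g) dt, with (f, P g) = (1/(2 pi)) (phi, g) (f, phi).\<close>
definition G_term :: "(real \<Rightarrow> complex) \<Rightarrow> (real \<Rightarrow> complex) \<Rightarrow> nat \<Rightarrow> complex" where
  "G_term f g N = set_lebesgue_integral lborel {0..2*pi}
     (\<lambda>t. complex_of_real t * (complex_of_real (1 / (2 * pi)) * ip (phi_t t N) g * ip f (phi_t t N)))"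

text \<open>T_G: the (a.e.-unique) operator with lim_N G_term f g N = (f, T_G g).\<close>
definition T_G :: "(real \<Rightarrow> complex) \<Rightarrow> real \<Rightarrow> complex" where
  "T_G = (SOME T. (\<forall>g\<in>L2. T g \<in> L2) \<and>
            (\<forall>f\<in>L2. \<forall>g\<in>L2. (G_term f g \<longlongrightarrow> ip f (T g)) sequentially))"

definition tG_form :: "(real \<Rightarrow> complex) \<Rightarrow> (real \<Rightarrow> complex) \<Rightarrow> complex" where
  "tG_form \<phi> \<psi> = (ip \<phi> (T_G \<psi>) + ip (T_G \<phi>) \<psi>) / 2"

end

theory Submission
  imports Defs "HOL-Probability.Distributions" "HOL-Real_Asymp.Real_Asymp"
begin

text \<open>Each Gaussian \<open>exp (- a x\<^sup>2 / 2)\<close> with \<open>0 < a < 1\<close> satisfies \<open>t f = \<i> a f\<close>, hence lies in the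
  domain of \<open>S\<close> with \<open>S f = - \<i> artanh a f\<close>. Evaluating \<open>t_form\<close> on the Gaussians with parameters
  \<open>1/2\<close> and \<open>a\<close>, whose overlap stays away from zero, and letting \<open>a\<close> tend to \<open>1\<close> shows that
  \<open>t_form\<close> is unbounded. (Diagonal values would not do: they are bounded on Gaussians.)

  In the coefficients with respect to the Hermite functions, \<open>T_G\<close> is the Toeplitz form with symbol
  \<open>t\<close> on \<open>[0, 2 \<pi>]\<close>, which is bounded by \<open>2 \<pi>\<close> by Parseval's identity and the Cauchy-Schwarz
  inequality. Bessel's inequality for the \<open>e_n\<close> suffices; their completeness plays no role.\<close>

text \<open>The eigenvalues - \<i> artanh a are purely imaginary, so the symmetrisation in
  \<open>t_form\<close> subtracts them: between two Gaussians only the difference of two values of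
  artanh survives, and on the diagonal nothing does. Hence one parameter stays fixed while the other
  approaches 1, where artanh blows up. Boundedness of \<open>tG_form\<close> then separates the two
  forms: if they agreed on \<open>form_dom\<close>, the bound would carry over to
  \<open>t_form\<close>. Much of the remaining work comes from Hilbert choice. \<open>S_app\<close>
  is an arbitrary representative, so the eigenvalue equation says something about it only once
  \<open>S_rel\<close> is known to be single-valued up to null sets; this reduces to the a.e.
  uniqueness of the derivative behind \<open>p_rel\<close>. Likewise \<open>T_G\<close> has the
  intended limits only if some operator has them. Its values are built from their Hermite
  coefficients, obtained as limits of finite sections of a matrix, whence the sequence-space
  argument and the completeness of \<open>L2\<close>.\<close>

lemma Cauchy_Schwarz_integral:
  fixes f g :: "'a \<Rightarrow> 'b::{real_normed_algebra, second_countable_topology}"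
  assumes [measurable]: "f \<in> borel_measurable M" "g \<in> borel_measurable M"
    and f: "integrable M (\<lambda>x. (norm (f x))^2)" and g: "integrable M (\<lambda>x. (norm (g x))^2)"
  shows "integrable M (\<lambda>x. norm (f x) * norm (g x))"
    and "(LINT x|M. norm (f x) * norm (g x))
           \<le> sqrt (LINT x|M. (norm (f x))^2) * sqrt (LINT x|M. (norm (g x))^2)"
proof -
  show int: "integrable M (\<lambda>x. norm (f x) * norm (g x))"
  proof (rule Bochner_Integration.integrable_bound)
    show "integrable M (\<lambda>x. (norm (f x))^2 + (norm (g x))^2)"
      using f g by simp
    have "norm (f x) * norm (g x) \<le> (norm (f x))^2 + (norm (g x))^2" for x
    proof -
      have "0 \<le> norm (f x) * norm (g x)" by simp
      then show ?thesis
        using sum_squares_bound[of "norm (f x)" "norm (g x)", unfolded mult.assoc] by linarith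
    qed
    then show "AE x in M. norm (norm (f x) * norm (g x))
        \<le> norm ((norm (f x))^2 + (norm (g x))^2)"
      by (simp add: abs_mult)
  qed simp
  let ?I = "LINT x|M. norm (f x) * norm (g x)"
  let ?A = "LINT x|M. (norm (f x))^2" and ?B = "LINT x|M. (norm (g x))^2"
  \<comment> \<open>The inequality is taken over from extended nonnegative integrals; integrability
    turns all three of them into real numbers.\<close>
  have "(\<integral>\<^sup>+x. ennreal (norm (f x)) * ennreal (norm (g x)) \<partial>M)\<^sup>2
      \<le> (\<integral>\<^sup>+x. ennreal (norm (f x)) ^ 2 \<partial>M) * (\<integral>\<^sup>+x. ennreal (norm (g x)) ^ 2 \<partial>M)"
    by (rule Cauchy_Schwarz_nn_integral) simp_all
  also have "(\<integral>\<^sup>+x. ennreal (norm (f x)) * ennreal (norm (g x)) \<partial>M) = ennreal ?I"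
    using int by (subst nn_integral_eq_integral[symmetric]) (auto simp: ennreal_mult)
  also have "(\<integral>\<^sup>+x. ennreal (norm (f x)) ^ 2 \<partial>M) = ennreal ?A"
    using f by (subst nn_integral_eq_integral[symmetric]) (auto simp: ennreal_power)
  also have "(\<integral>\<^sup>+x. ennreal (norm (g x)) ^ 2 \<partial>M) = ennreal ?B"
    using g by (subst nn_integral_eq_integral[symmetric]) (auto simp: ennreal_power)
  finally have "?I^2 \<le> ?A * ?B"
    by (simp add: ennreal_power ennreal_mult'[symmetric])
  then show "?I \<le> sqrt ?A * sqrt ?B"
    by (simp add: real_le_rsqrt real_sqrt_mult[symmetric])
qed

text \<open>Cancels one factor \<open>sqrt A\<close>. Such an inequality arises whenever a vector is
  tested against its own truncation, as in Bessel's inequality and in the bound for represented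
  coefficients.\<close>

lemma sqrt_le_of_square_le_mult:
  assumes "0 \<le> A" "0 \<le> B" "A \<le> B * sqrt A"
  shows "sqrt A \<le> B"
proof (cases "A = 0")
  case False
  then have "0 < sqrt A" using assms(1) by simp
  moreover have "sqrt A * sqrt A \<le> B * sqrt A" using assms by simp
  ultimately show ?thesis by (rule mult_right_le_imp_le[rotated])
qed (use assms in simp)

section \<open>The space \<open>L\<^sup>2(\<real>)\<close>\<close>

lemma L2_measurable [measurable_dest]: "f \<in> L2 \<Longrightarrow> f \<in> borel_measurable lborel"
  by (simp add: L2_def)

lemma L2_integrable: "f \<in> L2 \<Longrightarrow> integrable lborel (\<lambda>x. (norm (f x))^2)"
  by (simp add: L2_def)

lemma borel_measurable_cnj [measurable]:
  "f \<in> borel_measurable M \<Longrightarrow> (\<lambda>x. cnj (f x)) \<in> borel_measurable M"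
  by (rule measurable_compose[OF _ borel_measurable_continuous_onI[OF continuous_on_cnj[OF continuous_on_id]]])

lemma integrable_ip:
  assumes "f \<in> L2" "g \<in> L2"
  shows "integrable lborel (\<lambda>x. cnj (f x) * g x)"
proof (rule Bochner_Integration.integrable_bound)
  show "integrable lborel (\<lambda>x. norm (f x) * norm (g x))"
    using assms by (intro Cauchy_Schwarz_integral) (auto simp: L2_def)
  show "(\<lambda>x. cnj (f x) * g x) \<in> borel_measurable lborel"
    using assms[THEN L2_measurable] by measurable
qed (simp add: norm_mult)

lemma norm_ip_le:
  assumes "f \<in> L2" "g \<in> L2"
  shows "norm (ip f g) \<le> l2norm f * l2norm g"
proof -
  have "norm (ip f g) \<le> (LINT x|lborel. norm (f x) * norm (g x))"
    unfolding ip_def by (rule order_trans[OF integral_norm_bound]) (simp add: norm_mult)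
  also have "\<dots> \<le> l2norm f * l2norm g"
    unfolding l2norm_def using assms by (intro Cauchy_Schwarz_integral) (auto simp: L2_def)
  finally show ?thesis .
qed

lemma L2_zero: "(\<lambda>x. 0) \<in> L2"
  by (simp add: L2_def)

lemma L2_cmult:
  assumes "f \<in> L2" shows "(\<lambda>x. c * f x) \<in> L2"
  using assms by (auto simp: L2_def norm_mult power_mult_distrib)

lemma L2_add:
  assumes "f \<in> L2" "g \<in> L2" shows "(\<lambda>x. f x + g x) \<in> L2"
proof -
  have [measurable]: "f \<in> borel_measurable lborel" "g \<in> borel_measurable lborel"
    using assms by (simp_all add: L2_def)
  have "integrable lborel (\<lambda>x. (norm (f x + g x))^2)"
  proof (rule Bochner_Integration.integrable_bound)
    show "integrable lborel (\<lambda>x. 2 * (norm (f x))^2 + 2 * (norm (g x))^2)"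
      using assms by (simp add: L2_def)
    have "(norm (f x + g x))^2 \<le> 2 * (norm (f x))^2 + 2 * (norm (g x))^2" for x
      using power_mono[OF norm_triangle_ineq[of "f x" "g x"], of 2]
        sum_squares_bound[of "norm (f x)" "norm (g x)"]
      by (simp add: power2_sum)
    then show "AE x in lborel. norm ((norm (f x + g x))^2)
        \<le> norm (2 * (norm (f x))^2 + 2 * (norm (g x))^2)"
      by simp
  qed simp
  then show ?thesis by (simp add: L2_def)
qed

lemma L2_uminus: "f \<in> L2 \<Longrightarrow> (\<lambda>x. - f x) \<in> L2"
  by (simp add: L2_def)

lemma L2_diff: "f \<in> L2 \<Longrightarrow> g \<in> L2 \<Longrightarrow> (\<lambda>x. f x - g x) \<in> L2"
  using L2_add[of f "\<lambda>x. - g x"] L2_uminus[of g] by simp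

lemma L2_sum:
  assumes "\<And>i. i \<in> I \<Longrightarrow> f i \<in> L2"
  shows "(\<lambda>x. \<Sum>i\<in>I. f i x) \<in> L2"
  using assms
  by (induction I rule: infinite_finite_induct) (auto simp: L2_zero intro: L2_add)

lemma ip_commute: "ip g f = cnj (ip f g)"
  unfolding ip_def by (subst Bochner_Integration.integral_cnj[symmetric]) (simp add: mult.commute)

lemma ip_cmult_right: "ip f (\<lambda>x. c * g x) = c * ip f g"
  unfolding ip_def by (subst integral_mult_right_zero[symmetric]) (simp add: mult.left_commute)

lemma ip_cmult_left: "ip (\<lambda>x. c * f x) g = cnj c * ip f g"
  by (subst (1 2) ip_commute) (simp add: ip_cmult_right)

lemma ip_add_right:
  "f \<in> L2 \<Longrightarrow> g \<in> L2 \<Longrightarrow> h \<in> L2 \<Longrightarrow> ip f (\<lambda>x. g x + h x) = ip f g + ip f h"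
  unfolding ip_def by (simp add: integrable_ip distrib_left)

lemma ip_diff_right:
  "f \<in> L2 \<Longrightarrow> g \<in> L2 \<Longrightarrow> h \<in> L2 \<Longrightarrow> ip f (\<lambda>x. g x - h x) = ip f g - ip f h"
  unfolding ip_def by (simp add: integrable_ip right_diff_distrib)

lemma ip_sum_right:
  assumes "f \<in> L2" "\<And>i. i \<in> I \<Longrightarrow> g i \<in> L2"
  shows "ip f (\<lambda>x. \<Sum>i\<in>I. g i x) = (\<Sum>i\<in>I. ip f (g i))"
  unfolding ip_def using assms
  by (simp add: sum_distrib_left) (subst Bochner_Integration.integral_sum, auto intro: integrable_ip)

lemma ip_sum_left:
  assumes "f \<in> L2" "\<And>i. i \<in> I \<Longrightarrow> g i \<in> L2"
  shows "ip (\<lambda>x. \<Sum>i\<in>I. g i x) f = (\<Sum>i\<in>I. ip (g i) f)"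
  by (subst (1 2) ip_commute) (simp add: ip_sum_right[OF assms])

lemma l2norm_nonneg [simp]: "0 \<le> l2norm f"
  by (simp add: l2norm_def)

lemma l2norm_power2: "(l2norm f)^2 = (LINT x|lborel. (norm (f x))^2)"
  by (simp add: l2norm_def)

lemma ip_self: "ip f f = complex_of_real ((l2norm f)^2)"
  unfolding l2norm_power2 ip_def
  by (subst integral_complex_of_real[symmetric]) (simp add: complex_norm_square mult.commute del: of_real_power)

text \<open>Expand the inner product of the sum with itself in one argument only, apply
  Cauchy-Schwarz to both terms, and cancel one factor.\<close>

lemma l2norm_add_le:
  assumes "f \<in> L2" "g \<in> L2"
  shows "l2norm (\<lambda>x. f x + g x) \<le> l2norm f + l2norm g"
proof -
  let ?h = "\<lambda>x. f x + g x"
  have h: "?h \<in> L2" using assms by (rule L2_add)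
  have "(l2norm ?h)^2 = norm (ip ?h ?h)"
    by (simp add: ip_self norm_power)
  also have "\<dots> = norm (ip ?h f + ip ?h g)"
    using assms h by (simp add: ip_add_right)
  also have "\<dots> \<le> l2norm ?h * l2norm f + l2norm ?h * l2norm g"
    using norm_ip_le[OF h assms(1)] norm_ip_le[OF h assms(2)] norm_triangle_ineq
    by (meson add_mono order_trans)
  finally have "l2norm ?h * l2norm ?h \<le> l2norm ?h * (l2norm f + l2norm g)"
    by (simp add: power2_eq_square distrib_left)
  then show ?thesis
    using l2norm_nonneg[of ?h] l2norm_nonneg[of f] l2norm_nonneg[of g]
    by (cases "l2norm ?h = 0") (auto simp del: l2norm_nonneg)
qed

lemma l2norm_uminus: "l2norm (\<lambda>x. - f x) = l2norm f"
  by (simp add: l2norm_def)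

lemma l2norm_diff_le:
  assumes "f \<in> L2" "g \<in> L2"
  shows "l2norm (\<lambda>x. f x - g x) \<le> l2norm f + l2norm g"
  using l2norm_add_le[OF assms(1) L2_uminus[OF assms(2)]] by (simp add: l2norm_uminus)

lemma l2norm_eq_0_AE:
  assumes "f \<in> L2" "l2norm f = 0"
  shows "AE x in lborel. f x = 0"
  using integral_nonneg_eq_0_iff_AE[OF L2_integrable[OF assms(1)]] assms(2)
  by (simp add: l2norm_def)

lemma ip_cong_AE_right:
  assumes "AE x in lborel. g x = h x" "g \<in> L2" "h \<in> L2" "f \<in> L2"
  shows "ip f g = ip f h"
  unfolding ip_def
  using integrable_ip[OF assms(4,2)] integrable_ip[OF assms(4,3)] assms(1)
  by (intro integral_cong_AE) auto

lemma tendsto_ip_right: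
  assumes "f \<in> L2" "g \<in> L2" "\<And>n. s n \<in> L2"
    and lim: "(\<lambda>n. l2norm (\<lambda>x. s n x - g x)) \<longlonglongrightarrow> 0"
  shows "(\<lambda>n. ip f (s n)) \<longlonglongrightarrow> ip f g"
proof (rule LIM_zero_cancel, rule Lim_null_comparison)
  show "(\<lambda>n. l2norm f * l2norm (\<lambda>x. s n x - g x)) \<longlonglongrightarrow> 0"
    using tendsto_mult_right_zero[OF lim] .
  show "\<forall>\<^sub>F n in sequentially. norm (ip f (s n) - ip f g) \<le> l2norm f * l2norm (\<lambda>x. s n x - g x)"
    using norm_ip_le[OF assms(1) L2_diff[OF assms(3,2)]] assms
    by (intro always_eventually allI) (simp add: ip_diff_right)
qed

section \<open>Hermite functions\<close>

lemma integrable_power_gaussian: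
  assumes a: "0 < a"
  shows "integrable lborel (\<lambda>x::real. x^k * exp (- a * x^2))"
proof -
  \<comment> \<open>The standard deviation for which the centred normal density is a multiple of
    \<open>exp (- a * x^2)\<close>, so that its known moments apply.\<close>
  define s where "s = 1 / sqrt (2 * a)"
  have s: "0 < s" "2 * s^2 = 1 / a"
    using a by (auto simp: s_def power_divide)
  have "integrable lborel (\<lambda>x. normal_density 0 s x * (x - 0)^k)"
    using s(1) by (rule integrable_normal_moment)
  then have "integrable lborel (\<lambda>x. sqrt (2 * pi * s^2) * (normal_density 0 s x * (x - 0)^k))"
    by simp
  also have "(\<lambda>x. sqrt (2 * pi * s^2) * (normal_density 0 s x * (x - 0)^k))
      = (\<lambda>x. x^k * exp (- a * x^2))"
    using s a by (auto simp: normal_density_def fun_eq_iff mult.commute)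
  finally show ?thesis .
qed

lemma power_gaussian_L2:
  assumes "0 < a"
  shows "(\<lambda>x. complex_of_real (x^k * exp (- a * x^2 / 2))) \<in> L2"
proof -
  have "(norm (complex_of_real (x^k * exp (- a * x^2 / 2))))^2 = x^(2 * k) * exp (- a * x^2)" for x :: real
    unfolding norm_of_real power2_abs
    by (simp only: power_mult_distrib power_even_eq exp_double[symmetric]) simp
  then show ?thesis
    using integrable_power_gaussian[OF assms, of "2 * k"] by (simp add: L2_def)
qed

lemma tendsto_power_gaussian:
  assumes a: "0 < (a::real)"
  shows "((\<lambda>x::real. x^k * exp (- a * x^2)) \<longlongrightarrow> 0) at_top"
    and "((\<lambda>x::real. x^k * exp (- a * x^2)) \<longlongrightarrow> 0) at_bot"
proof -
  show top: "((\<lambda>x::real. x^k * exp (- a * x^2)) \<longlongrightarrow> 0) at_top"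
    using a by real_asymp
  \<comment> \<open>Reflection reduces the limit at minus infinity to the one at plus infinity; the
    sign \<open>(-1)^k\<close> makes up for the parity of the power.\<close>
  have "((\<lambda>x::real. (-1)^k * ((-x)^k * exp (- a * (-x)^2))) \<longlongrightarrow> (-1)^k * 0) at_bot"
    by (intro tendsto_mult tendsto_const filterlim_compose[OF top filterlim_uminus_at_top_at_bot])
  then show "((\<lambda>x::real. x^k * exp (- a * x^2)) \<longlongrightarrow> 0) at_bot"
    by (simp add: mult.assoc[symmetric] power_mult_distrib[symmetric])
qed

lemma integrable_poly_gaussian:
  assumes "0 < a" shows "integrable lborel (\<lambda>x::real. poly p x * exp (- a * x^2))"
proof -
  have "integrable lborel (\<lambda>x::real. \<Sum>i\<le>degree p. coeff p i * (x^i * exp (- a * x^2)))"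
    using integrable_power_gaussian[OF assms] by simp
  then show ?thesis by (simp add: poly_altdef sum_distrib_right mult.assoc)
qed

lemma tendsto_poly_gaussian:
  assumes "0 < a"
  shows "((\<lambda>x::real. poly p x * exp (- a * x^2)) \<longlongrightarrow> 0) at_top"
    and "((\<lambda>x::real. poly p x * exp (- a * x^2)) \<longlongrightarrow> 0) at_bot"
proof -
  have *: "(\<lambda>x::real. poly p x * exp (- a * x^2))
      = (\<lambda>x. \<Sum>i\<le>degree p. coeff p i * (x^i * exp (- a * x^2)))"
    by (simp add: poly_altdef sum_distrib_right mult.assoc)
  show "((\<lambda>x::real. poly p x * exp (- a * x^2)) \<longlongrightarrow> 0) at_top"
    unfolding * using tendsto_power_gaussian(1)[OF assms]
    by (intro tendsto_null_sum tendsto_mult_right_zero)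
  show "((\<lambda>x::real. poly p x * exp (- a * x^2)) \<longlongrightarrow> 0) at_bot"
    unfolding * using tendsto_power_gaussian(2)[OF assms]
    by (intro tendsto_null_sum tendsto_mult_right_zero)
qed

text \<open>The integrand is the derivative of \<open>poly p x * exp (- 1 * x^2)\<close>, which
  vanishes at both ends. This is integration by parts for the Gaussian weight.\<close>

lemma integral_deriv_poly_gaussian:
  fixes p :: "real poly"
  shows "(LINT x|lborel. poly (pderiv p - [:0, 2:] * p) x * exp (- 1 * x^2)) = 0"
proof -
  let ?F = "\<lambda>x. poly p x * exp (- 1 * x^2)"
  let ?f = "\<lambda>x. poly (pderiv p - [:0, 2:] * p) x * exp (- 1 * x^2)"
  have "(LBINT x=-\<infinity>..\<infinity>. ?f x) = 0 - 0"
  proof (rule interval_integral_FTC_integrable)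
    show "(?F has_vector_derivative ?f x) (at x)" for x
      by (auto simp: has_real_derivative_iff_has_vector_derivative[symmetric] algebra_simps
          intro!: derivative_eq_intros)
    show "set_integrable lborel (einterval (- \<infinity>) \<infinity>) ?f"
      using integrable_poly_gaussian[of 1] by (simp add: set_integrable_def del: poly_diff poly_mult)
    show "((?F \<circ> real_of_ereal) \<longlongrightarrow> 0) (at_right (- \<infinity>))"
      using tendsto_poly_gaussian(2)[of 1 p]
      by (simp add: at_right_MInf tendsto_compose_filtermap[symmetric] filtermap_filtermap comp_def
          filterlim_filtermap)
    show "((?F \<circ> real_of_ereal) \<longlongrightarrow> 0) (at_left \<infinity>)"
      using tendsto_poly_gaussian(1)[of 1 p]
      by (simp add: at_left_PInf filterlim_filtermap comp_def)
  qed (auto intro!: continuous_intros)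
  then show ?thesis
    by (simp add: interval_lebesgue_integral_def set_lebesgue_integral_def)
qed

text \<open>A copy of \<open>hermite\<close> in the polynomial ring, where formal derivatives and
  finiteness of the root set are available.\<close>

fun hermite_poly :: "nat \<Rightarrow> real poly" where
  "hermite_poly 0 = 1"
| "hermite_poly (Suc 0) = [:0, 2:]"
| "hermite_poly (Suc (Suc n))
     = [:0, 2:] * hermite_poly (Suc n) - smult (2 * real (Suc n)) (hermite_poly n)"

lemma poly_hermite_poly: "poly (hermite_poly n) x = hermite n x"
  by (induction n rule: hermite_poly.induct) (simp_all add: algebra_simps)

text \<open>Uniform in n: at n = 0 the truncated index \<open>n - 1\<close> is harmless because its
  coefficient vanishes.\<close>

lemma hermite_poly_rec:
  "hermite_poly (Suc n) = [:0, 2:] * hermite_poly n - smult (2 * real n) (hermite_poly (n - 1))"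
  by (cases n) simp_all

lemma pderiv_hermite_poly: "pderiv (hermite_poly n) = smult (2 * real n) (hermite_poly (n - 1))"
proof (induction n rule: hermite_poly.induct)
  case (3 n)
  have "poly (pderiv (hermite_poly (Suc (Suc n)))) x
      = poly (smult (2 * real (Suc (Suc n))) (hermite_poly (Suc n))) x" for x
  proof -
    have "poly (hermite_poly (Suc n)) x
        = 2 * x * poly (hermite_poly n) x - 2 * real n * poly (hermite_poly (n - 1)) x"
      by (simp add: hermite_poly_rec)
    then show ?thesis
      by (simp add: pderiv_mult pderiv_diff pderiv_smult 3 pderiv_pCons) (simp add: algebra_simps)
  qed
  then show ?case by (simp add: poly_eq_poly_eq_iff[symmetric] fun_eq_iff)
qed (simp_all add: pderiv_pCons)

text \<open>By the recursion and the derivative formula, H_{n+1} exp(-x^2) is minus the derivative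
  of H_n exp(-x^2). Integration by parts moves that derivative onto H_m, where it produces 2 m
  H_{m-1}.\<close>

lemma integral_hermite_Suc:
  "(LINT x|lborel. hermite (Suc n) x * hermite m x * exp (- (x^2)))
     = 2 * real m * (LINT x|lborel. hermite n x * hermite (m - 1) x * exp (- (x^2)))"
proof -
  let ?H = hermite_poly
  have eq: "poly (pderiv (?H n * ?H m) - [:0, 2:] * (?H n * ?H m)) x
      = 2 * real m * poly (?H n * ?H (m - 1)) x - poly (?H (Suc n) * ?H m) x" for x
    by (simp add: pderiv_mult pderiv_hermite_poly hermite_poly_rec algebra_simps)
  have int: "integrable lborel (\<lambda>x. poly p x * exp (- (x^2)))" for p :: "real poly"
    using integrable_poly_gaussian[of 1 p] by simp
  have "0 = (LINT x|lborel. 2 * real m * (poly (?H n * ?H (m - 1)) x * exp (- (x^2)))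
      - poly (?H (Suc n) * ?H m) x * exp (- (x^2)))"
    using integral_deriv_poly_gaussian[of "?H n * ?H m"] unfolding eq
    by (simp only: left_diff_distrib mult.assoc) (simp add: algebra_simps)
  also have "\<dots> = 2 * real m * (LINT x|lborel. poly (?H n * ?H (m - 1)) x * exp (- (x^2)))
      - (LINT x|lborel. poly (?H (Suc n) * ?H m) x * exp (- (x^2)))"
    using int by (simp del: poly_mult)
  finally show ?thesis by (simp add: poly_hermite_poly)
qed

text \<open>Both indices are lowered together until the smaller one is 0, where the factor
  \<open>2 * real m\<close> kills the integral.\<close>

lemma hermite_orthogonal_less:
  "m < n \<Longrightarrow> (LINT x|lborel. hermite n x * hermite m x * exp (- (x^2))) = 0"
proof (induction m arbitrary: n)
  case 0
  then show ?case using integral_hermite_Suc[of "n - 1" 0] by simp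
next
  case (Suc m)
  then show ?case using integral_hermite_Suc[of "n - 1" "Suc m"] Suc.IH[of "n - 1"] by simp
qed

lemma hermite_orthogonal:
  "m \<noteq> n \<Longrightarrow> (LINT x|lborel. hermite n x * hermite m x * exp (- (x^2))) = 0"
  using hermite_orthogonal_less[of m n] hermite_orthogonal_less[of n m]
  by (cases "m < n") (simp_all add: mult.commute)

text \<open>The derivative of each polynomial is a nonzero multiple of its predecessor, so a zero
  would propagate down to the constant 1.\<close>

lemma hermite_poly_nonzero: "hermite_poly n \<noteq> 0"
proof (induction n)
  case (Suc n)
  show ?case
  proof
    assume *: "hermite_poly (Suc n) = 0"
    then have "smult (2 * real (Suc n)) (hermite_poly n) = 0"
      using pderiv_hermite_poly[of "Suc n"] by simp
    then show False using Suc by simp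
  qed
qed simp

text \<open>Keeps the normalisation \<open>herm_c\<close> from dividing by zero. The integrand
  vanishes only at the finitely many roots of a nonzero polynomial.\<close>

lemma integral_hermite_square_pos: "0 < (LINT x|lborel. (hermite n x * exp (- (x^2) / 2))^2)"
proof -
  let ?f = "\<lambda>x. (hermite n x * exp (- (x^2) / 2))^2"
  have eq: "?f = (\<lambda>x. poly (hermite_poly n * hermite_poly n) x * exp (- 1 * x^2))"
    by (auto simp: poly_hermite_poly power2_eq_square mult_exp_exp algebra_simps)
  have int: "integrable lborel ?f"
    unfolding eq by (rule integrable_poly_gaussian) simp
  have "\<not> (AE x in lborel. ?f x = 0)"
  proof
    assume "AE x in lborel. ?f x = 0"
    then have ae: "AE x in lborel. poly (hermite_poly n) x = 0" by (simp add: poly_hermite_poly)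
    have "finite {x. poly (hermite_poly n) x = 0}"
      using hermite_poly_nonzero poly_roots_finite by blast
    then have "AE x in lborel. x \<notin> {x. poly (hermite_poly n) x = 0}"
      by (intro AE_not_in) (simp add: countable_imp_null_set_lborel countable_finite)
    with ae have "AE x in (lborel::real measure). False" by eventually_elim simp
    then show False using ae_filter_eq_bot_iff[of "lborel :: real measure"]
      by (simp add: trivial_limit_def)
  qed
  then have "(LINT x|lborel. ?f x) \<noteq> 0"
    using integral_nonneg_eq_0_iff_AE[OF int] by simp
  moreover have "(LINT x|lborel. ?f x) \<ge> 0" by simp
  ultimately show ?thesis by linarith
qed

section \<open>The orthonormal system \<open>e_fun\<close> and Bessel's inequality\<close>

lemma e_fun_L2: "e_fun n \<in> L2"
proof -
  have eq: "(\<lambda>x. (norm (e_fun n x))^2)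
      = (\<lambda>x. (herm_c n)^2 * (poly (hermite_poly n * hermite_poly n) x * exp (- 1 * x^2)))"
    unfolding e_fun_def norm_of_real power2_abs
    by (auto simp: poly_hermite_poly power2_eq_square mult_exp_exp algebra_simps)
  have "e_fun n = (\<lambda>x. complex_of_real (herm_c n * poly (hermite_poly n) x * exp (- (x^2) / 2)))"
    by (simp add: e_fun_def poly_hermite_poly)
  moreover have "\<dots> \<in> borel_measurable lborel"
    unfolding poly_altdef by measurable
  ultimately show ?thesis
    using integrable_poly_gaussian[of 1 "hermite_poly n * hermite_poly n"]
    unfolding L2_def mem_Collect_eq eq by (simp del: poly_mult)
qed

lemma e_fun_orthonormal: "ip (e_fun m) (e_fun n) = (if m = n then 1 else 0)"
proof -
  have "ip (e_fun m) (e_fun n) = (LINT x|lborel. complex_of_real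
      (herm_c m * herm_c n * (hermite n x * hermite m x * exp (- (x^2)))))"
    unfolding ip_def e_fun_def
    by (rule Bochner_Integration.integral_cong)
       (simp_all add: mult_exp_exp algebra_simps flip: of_real_mult)
  also have "\<dots> = complex_of_real (herm_c m * herm_c n *
      (LINT x|lborel. hermite n x * hermite m x * exp (- (x^2))))"
    by (simp only: integral_complex_of_real integral_mult_right_zero)
  also have "\<dots> = (if m = n then 1 else 0)"
  proof (cases "m = n")
    case True
    have "(\<lambda>x. hermite n x * hermite n x * exp (- (x^2))) = (\<lambda>x. (hermite n x * exp (- (x^2) / 2))^2)"
      by (auto simp: power2_eq_square mult_exp_exp algebra_simps)
    with True show ?thesis
      using integral_hermite_square_pos[of n] by (simp add: herm_c_def)
  qed (simp add: hermite_orthogonal)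
  finally show ?thesis .
qed

lemma l2norm_sum_e_fun:
  "(l2norm (\<lambda>x. \<Sum>n\<in>I. c n * e_fun n x))^2 = (\<Sum>n\<in>I. (norm (c n))^2)" if "finite I"
proof -
  let ?s = "\<lambda>x. \<Sum>n\<in>I. c n * e_fun n x"
  have s: "?s \<in> L2" by (intro L2_sum L2_cmult e_fun_L2)
  have "ip ?s ?s = (\<Sum>n\<in>I. \<Sum>m\<in>I. c n * (cnj (c m) * (if m = n then 1 else 0)))"
    using s by (simp add: ip_sum_right ip_sum_left L2_cmult e_fun_L2 ip_cmult_right ip_cmult_left
        e_fun_orthonormal sum_distrib_left)
  also have "\<dots> = complex_of_real (\<Sum>n\<in>I. (norm (c n))^2)"
    using that by (simp add: if_distrib complex_norm_square cong: if_cong del: of_real_power)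
  finally show ?thesis unfolding ip_self of_real_eq_iff .
qed

text \<open>With s the partial expansion of f and A its squared norm, the inner product of f and s
  also equals A, so Cauchy-Schwarz gives A \<le> \<open>l2norm f * sqrt A\<close>.\<close>

lemma Bessel_e_fun:
  assumes f: "f \<in> L2"
  shows "(\<Sum>n\<le>N. (norm (ip (e_fun n) f))^2) \<le> (l2norm f)^2"
proof -
  define c where "c = (\<lambda>n. ip (e_fun n) f)"
  let ?s = "\<lambda>x. \<Sum>n\<le>N. c n * e_fun n x"
  let ?A = "\<Sum>n\<le>N. (norm (c n))^2"
  have s: "?s \<in> L2" by (intro L2_sum L2_cmult e_fun_L2)
  have "ip f ?s = (\<Sum>n\<le>N. c n * cnj (c n))"
    using f by (simp add: ip_sum_right L2_cmult e_fun_L2 ip_cmult_right c_def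
        ip_commute[of f "e_fun _"])
  also have "\<dots> = complex_of_real ?A"
    by (simp add: complex_norm_square del: of_real_power)
  finally have *: "ip f ?s = complex_of_real ?A" .
  have A: "0 \<le> ?A" by (simp add: sum_nonneg)
  have "?A \<le> l2norm f * l2norm ?s"
    using norm_ip_le[OF f s] A unfolding * by (simp only: norm_of_real abs_of_nonneg)
  also have "l2norm ?s = sqrt ?A"
    using l2norm_sum_e_fun[of "{..N}" c] by (metis finite_atMost l2norm_nonneg real_sqrt_unique)
  finally have "sqrt ?A \<le> l2norm f"
    using A by (intro sqrt_le_of_square_le_mult) simp_all
  then show ?thesis
    using A unfolding c_def by (simp add: sqrt_le_D)
qed

section \<open>Bounded sesquilinear forms on square-summable sequences\<close>

text \<open>A finite section of an infinite matrix as a form antilinear in x. The size N comes last,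
  so that \<open>kernel_form a x y\<close> is the sequence whose limit is sought.\<close>

definition kernel_form ::
    "(nat \<Rightarrow> nat \<Rightarrow> complex) \<Rightarrow> (nat \<Rightarrow> complex) \<Rightarrow> (nat \<Rightarrow> complex) \<Rightarrow> nat \<Rightarrow> complex" where
  "kernel_form a x y N = (\<Sum>m\<le>N. \<Sum>n\<le>N. a m n * cnj (x m) * y n)"

text \<open>Truncation by zeros leaves the section size N free, so the cut-off M can be fixed while
  N tends to infinity.\<close>

definition head :: "nat \<Rightarrow> (nat \<Rightarrow> complex) \<Rightarrow> nat \<Rightarrow> complex" where
  "head M x = (\<lambda>m. if m \<le> M then x m else 0)"

definition tail :: "nat \<Rightarrow> (nat \<Rightarrow> complex) \<Rightarrow> nat \<Rightarrow> complex" where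
  "tail M x = (\<lambda>m. if m \<le> M then 0 else x m)"

lemma kernel_form_split_left:
  "kernel_form a x y N = kernel_form a (head M x) y N + kernel_form a (tail M x) y N"
  unfolding kernel_form_def sum.distrib[symmetric]
  by (intro sum.cong) (auto simp: head_def tail_def)

lemma kernel_form_split_right:
  "kernel_form a x y N = kernel_form a x (head M y) N + kernel_form a x (tail M y) N"
  unfolding kernel_form_def sum.distrib[symmetric]
  by (intro sum.cong) (auto simp: head_def tail_def)

lemma sum_head:
  fixes f :: "nat \<Rightarrow> complex"
  assumes "M \<le> N"
  shows "(\<Sum>m\<le>N. if m \<le> M then f m else 0) = (\<Sum>m\<le>M. f m)"
proof -
  have "{..N} \<inter> {m. m \<le> M} = {..M}" using assms by auto
  then show ?thesis by (simp add: sum.If_cases)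
qed

lemma kernel_form_head_left:
  assumes "M \<le> N"
  shows "kernel_form a (head M x) y N = (\<Sum>m\<le>M. cnj (x m) * (\<Sum>n\<le>N. a m n * y n))"
proof -
  have "kernel_form a (head M x) y N
      = (\<Sum>m\<le>N. if m \<le> M then cnj (x m) * (\<Sum>n\<le>N. a m n * y n) else 0)"
    unfolding kernel_form_def
    by (rule sum.cong) (auto simp: head_def sum_distrib_left mult_ac)
  then show ?thesis using sum_head[OF assms] by simp
qed

lemma kernel_form_head_head:
  assumes "M \<le> N"
  shows "kernel_form a (head M x) (head M y) N = kernel_form a x y M"
proof -
  have "(\<Sum>n\<le>N. a m n * head M y n) = (\<Sum>n\<le>M. a m n * y n)" for m
    using sum_head[OF assms, of "\<lambda>n. a m n * y n"]
    by (simp add: head_def if_distrib cong: if_cong)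
  then show ?thesis
    unfolding kernel_form_head_left[OF assms]
    by (simp add: kernel_form_def sum_distrib_left mult_ac)
qed

lemma sum_norm_head_le:
  assumes "summable (\<lambda>m. (norm (x m))^2)"
  shows "(\<Sum>m\<le>N. (norm (head M x m))^2) \<le> (\<Sum>m. (norm (x m))^2)"
proof -
  have "(\<Sum>m\<le>N. (norm (head M x m))^2) \<le> (\<Sum>m\<le>N. (norm (x m))^2)"
    by (rule sum_mono) (simp add: head_def)
  also have "\<dots> \<le> (\<Sum>m. (norm (x m))^2)"
    using assms by (intro sum_le_suminf) auto
  finally show ?thesis .
qed

lemma sum_norm_tail_le:
  assumes "summable (\<lambda>m. (norm (x m))^2)"
  shows "(\<Sum>m\<le>N. (norm (tail M x m))^2)
     \<le> (\<Sum>m. (norm (x m))^2) - (\<Sum>m\<le>M. (norm (x m))^2)"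
proof -
  \<comment> \<open>The enlarged range contains \<open>{..M}\<close> even if N < M, which the later
    subtraction of sums requires.\<close>
  have "(\<Sum>m\<le>N. (norm (tail M x m))^2) \<le> (\<Sum>m\<in>{..max M N}. (norm (tail M x m))^2)"
    by (intro sum_mono2) auto
  also have "\<dots> = (\<Sum>m\<in>{..max M N} - {..M}. (norm (x m))^2)"
    by (rule sum.mono_neutral_cong_right) (auto simp: tail_def)
  also have "\<dots> = (\<Sum>m\<in>{..max M N}. (norm (x m))^2) - (\<Sum>m\<le>M. (norm (x m))^2)"
    by (rule sum_diff) auto
  also have "(\<Sum>m\<in>{..max M N}. (norm (x m))^2) \<le> (\<Sum>m. (norm (x m))^2)"
    using assms by (intro sum_le_suminf) auto
  finally show ?thesis by simp
qed

lemma tail_tendsto_0: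
  fixes x :: "nat \<Rightarrow> complex"
  assumes "summable (\<lambda>m. (norm (x m))^2)"
  shows "(\<lambda>M. sqrt ((\<Sum>m. (norm (x m))^2) - (\<Sum>m\<le>M. (norm (x m))^2))) \<longlonglongrightarrow> 0"
proof -
  have "(\<lambda>M. sqrt ((\<Sum>m. (norm (x m))^2) - (\<Sum>m\<le>M. (norm (x m))^2)))
      \<longlonglongrightarrow> sqrt ((\<Sum>m. (norm (x m))^2) - (\<Sum>m. (norm (x m))^2))"
    by (intro tendsto_intros summable_LIMSEQ'[OF assms])
  then show ?thesis by simp
qed

text \<open>The matrix enters only through a bound on its finite sections that is uniform in
  N.\<close>

locale bounded_kernel =
  fixes a :: "nat \<Rightarrow> nat \<Rightarrow> complex" and C :: real
  assumes C: "0 \<le> C"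
    and bound: "norm (kernel_form a x y N)
      \<le> C * sqrt (\<Sum>m\<le>N. (norm (x m))^2) * sqrt (\<Sum>n\<le>N. (norm (y n))^2)"
begin

lemma kernel_form_le:
  assumes "(\<Sum>m\<le>N. (norm (x m))^2) \<le> X" "(\<Sum>n\<le>N. (norm (y n))^2) \<le> Y"
  shows "norm (kernel_form a x y N) \<le> C * sqrt X * sqrt Y"
proof -
  have "C * sqrt (\<Sum>m\<le>N. (norm (x m))^2) * sqrt (\<Sum>n\<le>N. (norm (y n))^2) \<le> C * sqrt X * sqrt Y"
    using assms C order_trans[OF sum_nonneg assms(1)]
    by (intro mult_mono real_sqrt_le_mono) (auto simp: sum_nonneg)
  then show ?thesis using bound[of x y N] by linarith
qed

text \<open>For M \<le> N the sections differ by two terms, each with a tail beyond M in one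
  argument. The uniform bound makes both small independently of N.\<close>

lemma kernel_form_convergent:
  assumes x: "summable (\<lambda>m. (norm (x m))^2)" and y: "summable (\<lambda>n. (norm (y n))^2)"
  shows "convergent (kernel_form a x y)"
proof -
  let ?X = "\<lambda>M. \<Sum>m\<le>M. (norm (x m))^2" and ?Xs = "\<Sum>m. (norm (x m))^2"
  let ?Y = "\<lambda>M. \<Sum>m\<le>M. (norm (y m))^2" and ?Ys = "\<Sum>m. (norm (y m))^2"
  define E where "E M = C * sqrt (?Xs - ?X M) * sqrt ?Ys + C * sqrt ?Xs * sqrt (?Ys - ?Y M)" for M
  have E: "E \<longlonglongrightarrow> 0"
    unfolding E_def
    by (intro tendsto_add_zero tendsto_mult_left_zero tendsto_mult_right_zero
        tail_tendsto_0 x y)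
  have le: "norm (kernel_form a x y N - kernel_form a x y M) \<le> E M" if "M \<le> N" for M N
  proof -
    have "kernel_form a x y N - kernel_form a x y M
        = kernel_form a (tail M x) y N + kernel_form a (head M x) (tail M y) N"
      using kernel_form_split_left[of a x y N M]
        kernel_form_split_right[of a "head M x" y N M] kernel_form_head_head[OF that, of a x y]
      by simp
    moreover have "norm (kernel_form a (tail M x) y N) \<le> C * sqrt (?Xs - ?X M) * sqrt ?Ys"
      using y by (intro kernel_form_le sum_norm_tail_le x sum_le_suminf) auto
    moreover have "norm (kernel_form a (head M x) (tail M y) N) \<le> C * sqrt ?Xs * sqrt (?Ys - ?Y M)"
      by (intro kernel_form_le sum_norm_tail_le sum_norm_head_le x y)
    ultimately show ?thesis unfolding E_def by (metis add_mono norm_triangle_le)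
  qed
  have "Cauchy (kernel_form a x y)"
  proof (rule CauchyI')
    fix e :: real assume "0 < e"
    then obtain M0 where M0: "\<And>M. M \<ge> M0 \<Longrightarrow> norm (E M) < e"
      using LIMSEQ_D[OF E] by (metis diff_zero)
    have "norm (kernel_form a x y m - kernel_form a x y n) < e" if "M0 \<le> m" "m < n" for m n
      using le[of m n] M0[of m] that by (simp add: norm_minus_commute)
    then show "\<exists>M. \<forall>m\<ge>M. \<forall>n>m. dist (kernel_form a x y m) (kernel_form a x y n) < e"
      unfolding dist_norm by blast
  qed
  then show ?thesis by (rule Cauchy_convergent)
qed

text \<open>Riesz representation in coordinates: \<open>c\<close> is the image of \<open>y\<close>
  under the infinite matrix. The common limit \<open>l\<close> records that summing over n
  completely before summing over m gives the same value as the square sections.\<close>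

lemma kernel_form_representation:
  assumes y: "summable (\<lambda>n. (norm (y n))^2)"
  obtains c where "summable (\<lambda>m. (norm (c m))^2)"
    and "\<And>x. summable (\<lambda>m. (norm (x m))^2) \<Longrightarrow>
      \<exists>l. kernel_form a x y \<longlonglongrightarrow> l \<and> (\<lambda>M. \<Sum>m\<le>M. cnj (x m) * c m) \<longlonglongrightarrow> l"
proof -
  let ?Ys = "\<Sum>m. (norm (y m))^2"
  have "convergent (\<lambda>N. \<Sum>n\<le>N. a m n * y n)" for m
  proof -
    \<comment> \<open>A unit sequence in the first slot isolates row m, so convergence of the form
      yields convergence of that row applied to \<open>y\<close>.\<close>
    let ?d = "\<lambda>i. if i = m then 1 else 0 :: complex"
    have sd: "summable (\<lambda>i. (norm (?d i))^2)"
      by (rule summable_finite[of "{m}"]) auto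
    have "kernel_form a ?d y N = (\<Sum>n\<le>N. a m n * y n)" if "N \<ge> m" for N
    proof -
      have "kernel_form a ?d y N = (\<Sum>i\<le>N. if i = m then \<Sum>n\<le>N. a m n * y n else 0)"
        unfolding kernel_form_def by (rule sum.cong) auto
      with that show ?thesis by simp
    qed
    then have "\<forall>\<^sub>F N in sequentially. kernel_form a ?d y N = (\<Sum>n\<le>N. a m n * y n)"
      by (auto simp: eventually_sequentially)
    with kernel_form_convergent[OF sd y] show ?thesis
      using tendsto_cong unfolding convergent_def by fast
  qed
  then obtain c where c: "\<And>m. (\<lambda>N. \<Sum>n\<le>N. a m n * y n) \<longlonglongrightarrow> c m"
    unfolding convergent_def by metis
  have head_lim: "kernel_form a (head M x) y \<longlonglongrightarrow> (\<Sum>m\<le>M. cnj (x m) * c m)" for M x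
  proof -
    have "(\<lambda>N. \<Sum>m\<le>M. cnj (x m) * (\<Sum>n\<le>N. a m n * y n)) \<longlonglongrightarrow> (\<Sum>m\<le>M. cnj (x m) * c m)"
      by (intro tendsto_intros c)
    moreover have "\<forall>\<^sub>F N in sequentially.
        kernel_form a (head M x) y N = (\<Sum>m\<le>M. cnj (x m) * (\<Sum>n\<le>N. a m n * y n))"
      unfolding eventually_sequentially using kernel_form_head_left by blast
    ultimately show ?thesis by (simp add: tendsto_cong)
  qed
  have c_le: "(\<Sum>m\<le>M. (norm (c m))^2) \<le> C^2 * ?Ys" for M
  proof -
    let ?A = "\<Sum>m\<le>M. (norm (c m))^2"
    have A: "0 \<le> ?A" by (simp add: sum_nonneg)
    \<comment> \<open>Duality: the form is tested against the truncation of \<open>c\<close> itself,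
      and the bound passes to the limit in N.\<close>
    have "norm (\<Sum>m\<le>M. cnj (c m) * c m) \<le> C * sqrt ?A * sqrt ?Ys"
    proof (rule LIMSEQ_le_const2[OF tendsto_norm[OF head_lim]], intro exI allI impI)
      fix N :: nat
      have "(\<Sum>m\<le>N. (norm (head M c m))^2) \<le> (\<Sum>m\<in>{..max M N}. (norm (head M c m))^2)"
        by (intro sum_mono2) auto
      also have "\<dots> = ?A"
        by (rule sum.mono_neutral_cong_right) (auto simp: head_def)
      finally show "norm (kernel_form a (head M c) y N) \<le> C * sqrt ?A * sqrt ?Ys"
        using y by (intro kernel_form_le sum_le_suminf) auto
    qed
    also have "(\<Sum>m\<le>M. cnj (c m) * c m) = complex_of_real ?A"
      by (simp add: complex_norm_square mult.commute del: of_real_power)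
    finally have "?A \<le> (C * sqrt ?Ys) * sqrt ?A"
      using A unfolding norm_of_real by (simp add: mult_ac)
    moreover have Y: "0 \<le> ?Ys" by (rule suminf_nonneg[OF y]) simp
    ultimately have "sqrt ?A \<le> C * sqrt ?Ys"
      using A C by (intro sqrt_le_of_square_le_mult) auto
    then have "(sqrt ?A)^2 \<le> (C * sqrt ?Ys)^2"
      using A by (intro power_mono) auto
    then show ?thesis using A Y by (simp add: power_mult_distrib)
  qed
  show thesis
  proof
    show "summable (\<lambda>m. (norm (c m))^2)"
      using c_le by (intro bounded_imp_summable[where B = "C^2 * ?Ys"]) auto
    fix x :: "nat \<Rightarrow> complex"
    assume x: "summable (\<lambda>m. (norm (x m))^2)"
    let ?X = "\<lambda>M. \<Sum>m\<le>M. (norm (x m))^2" and ?Xs = "\<Sum>m. (norm (x m))^2"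
    obtain l where l: "kernel_form a x y \<longlonglongrightarrow> l"
      using kernel_form_convergent[OF x y] by (auto simp: convergent_def)
    \<comment> \<open>The interchange of limits: for every N the truncated and the full form differ
      by the tail term alone, whose bound depends on M only.\<close>
    have le: "norm ((\<Sum>m\<le>M. cnj (x m) * c m) - l) \<le> C * sqrt (?Xs - ?X M) * sqrt ?Ys" for M
    proof (rule LIMSEQ_le_const2[OF tendsto_norm[OF tendsto_diff[OF head_lim l]]],
        intro exI allI impI)
      fix N
      have "norm (kernel_form a (tail M x) y N) \<le> C * sqrt (?Xs - ?X M) * sqrt ?Ys"
        using y by (intro kernel_form_le sum_norm_tail_le x sum_le_suminf) auto
      moreover have "kernel_form a (head M x) y N - kernel_form a x y N = - kernel_form a (tail M x) y N"
        using kernel_form_split_left[of a x y N M] by simp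
      ultimately show "norm (kernel_form a (head M x) y N - kernel_form a x y N)
          \<le> C * sqrt (?Xs - ?X M) * sqrt ?Ys"
        by (simp only: norm_minus_cancel)
    qed
    have lim0: "(\<lambda>M. C * sqrt (?Xs - ?X M) * sqrt ?Ys) \<longlonglongrightarrow> 0"
      by (intro tendsto_mult_left_zero tendsto_mult_right_zero tail_tendsto_0 x)
    have "(\<lambda>M. \<Sum>m\<le>M. cnj (x m) * c m) \<longlonglongrightarrow> l"
      by (rule LIM_zero_cancel, rule Lim_null_comparison[OF always_eventually[OF allI[OF le]] lim0])
    then show "\<exists>l. kernel_form a x y \<longlonglongrightarrow> l \<and> (\<lambda>M. \<Sum>m\<le>M. cnj (x m) * c m) \<longlonglongrightarrow> l"
      using l by blast
  qed
qed

end

section \<open>Completeness of \<open>L\<^sup>2(\<real>)\<close>\<close>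

text \<open>Multiplication by a Gaussian turns an \<open>L\<^sup>2\<close>-Cauchy sequence into an \<open>L\<^sup>1\<close>-Cauchy one,
  which yields an almost everywhere convergent subsequence; Fatou's lemma does the rest.\<close>

lemma L2_complete:
  assumes s: "\<And>n. s n \<in> L2"
    and cauchy: "\<And>e. 0 < e \<Longrightarrow> \<exists>N. \<forall>i\<ge>N. \<forall>j\<ge>N. l2norm (\<lambda>x. s i x - s j x) < e"
  obtains h where "h \<in> L2" "(\<lambda>n. l2norm (\<lambda>x. s n x - h x)) \<longlonglongrightarrow> 0"
proof -
  define w :: "real \<Rightarrow> complex" where "w = (\<lambda>x. complex_of_real (x^0 * exp (- 1 * x^2 / 2)))"
  have w: "w \<in> L2" unfolding w_def by (rule power_gaussian_L2) simp
  have w0: "w x \<noteq> 0" for x by (simp add: w_def)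
  have cw: "cnj (w x) = w x" for x by (simp add: w_def)
  define u where "u n x = cnj (w x) * s n x" for n x
  have [measurable]: "s n \<in> borel_measurable borel" for n using s[of n] by (simp add: L2_def)
  have "integrable lborel (u n)" for n
    unfolding u_def by (intro integrable_ip w s)
  moreover have "\<exists>N. \<forall>i\<ge>N. \<forall>j\<ge>N. LINT x|lborel. norm (u i x - u j x) < e" if "0 < e" for e
  proof -
    \<comment> \<open>The added 1 provides a positive denominator without evaluating the norm of the
      weight.\<close>
    have w1: "0 < l2norm w + 1" using l2norm_nonneg[of w] by linarith
    then have e: "0 < e / (l2norm w + 1)" using that by simp
    obtain N where N: "\<And>i j. i \<ge> N \<Longrightarrow> j \<ge> N \<Longrightarrow> l2norm (\<lambda>x. s i x - s j x) < e / (l2norm w + 1)"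
      using cauchy[OF e] by blast
    have "LINT x|lborel. norm (u i x - u j x) < e" if "i \<ge> N" "j \<ge> N" for i j
    proof -
      have d: "(\<lambda>x. s i x - s j x) \<in> L2" using s by (intro L2_diff)
      have "(LINT x|lborel. norm (u i x - u j x)) = (LINT x|lborel. norm (w x) * norm (s i x - s j x))"
        by (simp add: u_def right_diff_distrib[symmetric] norm_mult)
      also have "\<dots> \<le> l2norm w * l2norm (\<lambda>x. s i x - s j x)"
        unfolding l2norm_def using w d by (intro Cauchy_Schwarz_integral) (auto simp: L2_def)
      also have "\<dots> \<le> l2norm w * (e / (l2norm w + 1))"
        using N[OF that] by (intro mult_left_mono) auto
      also have "\<dots> < e"
        using \<open>0 < e\<close> w1 by (simp add: field_simps)
      finally show ?thesis .
    qed
    then show ?thesis by blast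
  qed
  ultimately obtain r where r: "strict_mono r" "AE x in lborel. Cauchy (\<lambda>i. u (r i) x)"
    using cauchy_L1_AE_cauchy_subseq[of lborel u] by blast
  define h where "h x = lim (\<lambda>i. s (r i) x)" for x
  have [measurable]: "h \<in> borel_measurable borel"
    unfolding h_def by measurable
  have lim_h: "AE x in lborel. (\<lambda>i. s (r i) x) \<longlonglongrightarrow> h x"
    using r(2)
  proof eventually_elim
    case (elim x)
    then obtain l where "(\<lambda>i. u (r i) x) \<longlonglongrightarrow> l"
      by (auto simp: Cauchy_convergent_iff convergent_def)
    then have "(\<lambda>i. u (r i) x / w x) \<longlonglongrightarrow> l / w x"
      using w0 by (intro tendsto_divide tendsto_const)
    then have "convergent (\<lambda>i. s (r i) x)"
      using w0 by (auto simp: u_def cw convergent_def)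
    then show ?case by (simp add: h_def convergent_LIMSEQ_iff)
  qed
  have close: "\<exists>N. \<forall>n\<ge>N. (\<lambda>x. s n x - h x) \<in> L2 \<and> l2norm (\<lambda>x. s n x - h x) \<le> e" if "0 < e" for e
  proof -
    obtain N where N: "\<And>i j. i \<ge> N \<Longrightarrow> j \<ge> N \<Longrightarrow> l2norm (\<lambda>x. s i x - s j x) < e"
      using cauchy[OF \<open>0 < e\<close>] by blast
    have "(\<lambda>x. s n x - h x) \<in> L2 \<and> l2norm (\<lambda>x. s n x - h x) \<le> e" if n: "n \<ge> N" for n
    proof -
      have "(\<integral>\<^sup>+x. ennreal ((norm (s n x - h x))^2) \<partial>lborel)
          = (\<integral>\<^sup>+x. liminf (\<lambda>i. ennreal ((norm (s n x - s (r i) x))^2)) \<partial>lborel)"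
      proof (rule nn_integral_cong_AE)
        show "AE x in lborel. ennreal ((norm (s n x - h x))^2)
            = liminf (\<lambda>i. ennreal ((norm (s n x - s (r i) x))^2))"
          using lim_h
        proof eventually_elim
          case (elim x)
          then have "(\<lambda>i. ennreal ((norm (s n x - s (r i) x))^2))
              \<longlonglongrightarrow> ennreal ((norm (s n x - h x))^2)"
            by (intro tendsto_intros tendsto_ennrealI)
          then show ?case by (rule lim_imp_Liminf[OF trivial_limit_sequentially, symmetric])
        qed
      qed
      also have "\<dots> \<le> liminf (\<lambda>i. \<integral>\<^sup>+x. ennreal ((norm (s n x - s (r i) x))^2) \<partial>lborel)"
        by (rule nn_integral_liminf) measurable
      also have "\<dots> \<le> limsup (\<lambda>i. \<integral>\<^sup>+x. ennreal ((norm (s n x - s (r i) x))^2) \<partial>lborel)"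
        by (rule Liminf_le_Limsup) simp
      also have "\<dots> \<le> ennreal (e^2)"
      proof (rule Limsup_bounded, unfold eventually_sequentially, intro exI allI impI)
        fix i assume "N \<le> i"
        then have ri: "r i \<ge> N" using seq_suble[OF r(1), of i] by linarith
        have "(\<integral>\<^sup>+x. ennreal ((norm (s n x - s (r i) x))^2) \<partial>lborel)
            = ennreal ((l2norm (\<lambda>x. s n x - s (r i) x))^2)"
          unfolding l2norm_power2 using L2_integrable[OF L2_diff[OF s s]]
          by (intro nn_integral_eq_integral) auto
        also have "\<dots> \<le> ennreal (e^2)"
          using N[OF n ri] by (intro ennreal_leI power_mono) auto
        finally show "(\<integral>\<^sup>+x. ennreal ((norm (s n x - s (r i) x))^2) \<partial>lborel) \<le> ennreal (e^2)" .
      qed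
      finally have le: "(\<integral>\<^sup>+x. ennreal ((norm (s n x - h x))^2) \<partial>lborel) \<le> ennreal (e^2)" .
      then have int: "integrable lborel (\<lambda>x. (norm (s n x - h x))^2)"
        by (intro integrableI_nonneg) (auto intro: order_le_less_trans)
      have "ennreal ((l2norm (\<lambda>x. s n x - h x))^2) \<le> ennreal (e^2)"
        using le nn_integral_eq_integral[OF int] by (simp add: l2norm_power2)
      then have "(l2norm (\<lambda>x. s n x - h x))^2 \<le> e^2"
        using \<open>0 < e\<close> by (simp add: ennreal_le_iff)
      then have "l2norm (\<lambda>x. s n x - h x) \<le> e"
        using \<open>0 < e\<close> by (rule_tac power2_le_imp_le) auto
      then show ?thesis using int by (simp add: L2_def)
    qed
    then show ?thesis by blast
  qed
  obtain n where "(\<lambda>x. s n x - h x) \<in> L2" using close[of 1] by auto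
  then have "h \<in> L2" using L2_diff[OF s[of n]] by fastforce
  moreover have "(\<lambda>n. l2norm (\<lambda>x. s n x - h x)) \<longlonglongrightarrow> 0"
  proof (rule LIMSEQ_I)
    fix e :: real assume "0 < e"
    then obtain N where "\<And>n. n \<ge> N \<Longrightarrow> l2norm (\<lambda>x. s n x - h x) \<le> e / 2"
      using close[of "e / 2"] by auto
    then show "\<exists>N. \<forall>n\<ge>N. norm (l2norm (\<lambda>x. s n x - h x) - 0) < e"
      using \<open>0 < e\<close> by (intro exI[of _ N]) fastforce
  qed
  ultimately show thesis using that by blast
qed

text \<open>By orthonormality the squared distance of two partial sums is the difference of the
  partial sums of the squared coefficients, so the Cauchy property carries over to
  \<open>L2\<close>.\<close>

lemma Riesz_Fischer_e_fun:
  assumes c: "summable (\<lambda>m. (norm (c m))^2)"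
  obtains h where "h \<in> L2" "(\<lambda>N. l2norm (\<lambda>x. (\<Sum>m\<le>N. c m * e_fun m x) - h x)) \<longlonglongrightarrow> 0"
proof (rule L2_complete[of "\<lambda>N x. \<Sum>m\<le>N. c m * e_fun m x"])
  show "(\<lambda>x. \<Sum>m\<le>N. c m * e_fun m x) \<in> L2" for N
    by (intro L2_sum L2_cmult e_fun_L2)
  fix e :: real assume e: "0 < e"
  let ?S = "\<lambda>N. \<Sum>m\<le>N. (norm (c m))^2"
  have eq: "(l2norm (\<lambda>x. (\<Sum>m\<le>i. c m * e_fun m x) - (\<Sum>m\<le>j. c m * e_fun m x)))^2 = \<bar>?S i - ?S j\<bar>"
    if "j \<le> i" for i j
  proof -
    have "(\<Sum>m\<le>i. c m * e_fun m x) - (\<Sum>m\<le>j. c m * e_fun m x)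
        = (\<Sum>m\<in>{..i} - {..j}. c m * e_fun m x)" for x
      using that by (subst sum_diff) auto
    moreover have "?S i - ?S j = (\<Sum>m\<in>{..i} - {..j}. (norm (c m))^2)"
      using that by (subst sum_diff) auto
    ultimately show ?thesis by (simp add: l2norm_sum_e_fun sum_nonneg)
  qed
  have "Cauchy ?S"
    using summable_LIMSEQ'[OF c] by (rule LIMSEQ_imp_Cauchy)
  then obtain N where N: "\<And>i j. i \<ge> N \<Longrightarrow> j \<ge> N \<Longrightarrow> \<bar>?S i - ?S j\<bar> < e^2"
    using e unfolding Cauchy_def dist_real_def by (metis zero_less_power)
  have "l2norm (\<lambda>x. (\<Sum>m\<le>i. c m * e_fun m x) - (\<Sum>m\<le>j. c m * e_fun m x)) < e"
    if "i \<ge> N" "j \<ge> N" for i j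
  proof -
    have "(l2norm (\<lambda>x. (\<Sum>m\<le>i. c m * e_fun m x) - (\<Sum>m\<le>j. c m * e_fun m x)))^2 = \<bar>?S i - ?S j\<bar>"
    proof (cases "j \<le> i")
      case False
      then show ?thesis
        using eq[of i j] l2norm_uminus[of "\<lambda>x. (\<Sum>m\<le>j. c m * e_fun m x) - (\<Sum>m\<le>i. c m * e_fun m x)"]
        by (simp add: abs_minus_commute)
    qed (rule eq)
    with N[OF that] have "(l2norm (\<lambda>x. (\<Sum>m\<le>i. c m * e_fun m x) - (\<Sum>m\<le>j. c m * e_fun m x)))^2 < e^2"
      by simp
    then show ?thesis using e by (rule_tac power2_less_imp_less) auto
  qed
  then show "\<exists>N. \<forall>i\<ge>N. \<forall>j\<ge>N.
      l2norm (\<lambda>x. (\<Sum>m\<le>i. c m * e_fun m x) - (\<Sum>m\<le>j. c m * e_fun m x)) < e"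
    by blast
qed (rule that)

section \<open>The operator \<open>T_G\<close>\<close>

text \<open>The factor by which exp(-ith) acts on \<open>e_fun n\<close>. The zero-point 1/2 cancels
  in \<open>phase m t * cnj (phase n t)\<close>.\<close>

definition phase :: "nat \<Rightarrow> real \<Rightarrow> complex" where
  "phase n t = exp (- \<i> * complex_of_real (t * (real n + 1/2)))"

text \<open>The integrand depends on n - m only, which is the Toeplitz structure. The entries are
  kept as integrals because the form is estimated under the integral sign.\<close>

definition G_kernel :: "nat \<Rightarrow> nat \<Rightarrow> complex" where
  "G_kernel m n = (LINT t:{0..2*pi}|lborel.
     complex_of_real (t / (2 * pi)) * (phase m t * cnj (phase n t)))"

lemma continuous_phase [continuous_intros]: "continuous_on A (phase n)"
  unfolding phase_def by (intro continuous_intros)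

lemma phase_mult_cnj:
  "phase m t * cnj (phase n t) = exp (\<i> * complex_of_real (t * (real n - real m)))"
  unfolding phase_def exp_cnj mult_exp_exp by (simp add: algebra_simps)

lemma integral_phase_mult_cnj:
  "(LINT t:{0..2*pi}|lborel. phase m t * cnj (phase n t)) = (if m = n then 2 * pi else 0)"
proof (cases "m = n")
  case True
  then show ?thesis by (simp add: phase_mult_cnj set_integral_const scaleR_conv_of_real)
next
  case False
  define k where "k = real n - real m"
  have k: "k \<noteq> 0" using False by (simp add: k_def)
  have k': "k = of_int (int n - int m)" by (simp add: k_def)
  have "(LINT t:{0..2*pi}|lborel. exp (\<i> * complex_of_real (t * k)))
      = exp (\<i> * complex_of_real (2 * pi * k)) / (\<i> * k) - exp (\<i> * complex_of_real (0 * k)) / (\<i> * k)"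
    unfolding set_lebesgue_integral_def
  proof (rule integral_FTC_atLeastAtMost)
    fix t :: real
    have "((\<lambda>z. exp (\<i> * (z * k)) / (\<i> * k)) has_field_derivative exp (\<i> * (t * k))) (at (complex_of_real t))"
      using k by (auto intro!: derivative_eq_intros simp: mult_ac)
    then have "((\<lambda>t. exp (\<i> * (of_real t * k)) / (\<i> * k)) has_vector_derivative exp (\<i> * (t * k))) (at t within {0..2*pi})"
      using has_vector_derivative_real_field by fastforce
    then show "((\<lambda>t. exp (\<i> * complex_of_real (t * k)) / (\<i> * k)) has_vector_derivative
        exp (\<i> * complex_of_real (t * k))) (at t within {0..2*pi})"
      by simp
  qed (auto intro!: continuous_intros)
  \<comment> \<open>The frequency is a nonzero integer, so the antiderivative takes equal values at
    both ends of the full period.\<close>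
  also have "exp (\<i> * complex_of_real (2 * pi * k)) = 1"
    unfolding k' by (rule exp_eq_1[THEN iffD2]) (simp add: exI[of _ "int n - int m"])
  finally show ?thesis using False by (simp add: phase_mult_cnj k_def)
qed

lemma set_integrable_phase:
  "continuous_on {0..2*pi} f \<Longrightarrow> set_integrable lborel {0..2*pi} (f :: real \<Rightarrow> complex)"
  by (rule borel_integrable_atLeastAtMost')

text \<open>The indicator sits inside the norm so that the trigonometric sum is a function on the
  whole line, as \<open>Cauchy_Schwarz_integral\<close> is applied to it there.\<close>

lemma Parseval_phase:
  "(LINT t|lborel. (norm (indicator {0..2*pi} t *\<^sub>R (\<Sum>n\<le>N. x n * phase n t)))^2)
     = 2 * pi * (\<Sum>n\<le>N. (norm (x n))^2)"
proof -
  let ?f = "\<lambda>t. \<Sum>n\<le>N. x n * phase n t"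
  have "complex_of_real (LINT t|lborel. (norm (indicator {0..2*pi} t *\<^sub>R ?f t))^2)
      = (LINT t:{0..2*pi}|lborel. ?f t * cnj (?f t))"
    unfolding set_lebesgue_integral_def integral_complex_of_real[symmetric]
    by (rule Bochner_Integration.integral_cong)
      (auto simp: indicator_def complex_norm_square simp del: of_real_power)
  also have "\<dots> = (LINT t:{0..2*pi}|lborel. \<Sum>m\<le>N. \<Sum>n\<le>N.
      x m * cnj (x n) * (phase m t * cnj (phase n t)))"
    by (simp add: sum_product mult_ac)
  also have "\<dots> = (\<Sum>m\<le>N. \<Sum>n\<le>N. x m * cnj (x n) *
      (LINT t:{0..2*pi}|lborel. phase m t * cnj (phase n t)))"
  proof -
    have "set_integrable lborel {0..2*pi} (\<lambda>t. phase m t * cnj (phase n t))" for m n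
      by (intro set_integrable_phase continuous_intros)
    then show ?thesis
      by (simp add: set_lebesgue_integral_def set_integrable_def scaleR_sum_right
          flip: mult_scaleR_right)
  qed
  also have "\<dots> = complex_of_real (2 * pi * (\<Sum>n\<le>N. (norm (x n))^2))"
    unfolding integral_phase_mult_cnj
    by (simp add: if_distrib complex_norm_square sum_distrib_left mult_ac cong: if_cong del: of_real_power)
  finally show ?thesis unfolding of_real_eq_iff .
qed

text \<open>The y-factor is written as the conjugate of a sum with conjugated coefficients; both
  factors then have the shape covered by \<open>Parseval_phase\<close>.\<close>

lemma kernel_form_G_kernel:
  "kernel_form G_kernel x y N = (LINT t:{0..2*pi}|lborel. complex_of_real (t / (2 * pi)) *
     ((\<Sum>m\<le>N. cnj (x m) * phase m t) * cnj (\<Sum>n\<le>N. cnj (y n) * phase n t)))"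
proof -
  have "set_integrable lborel {0..2*pi} (\<lambda>t. complex_of_real (t / (2 * pi)) * (phase m t * cnj (phase n t)))" for m n
    by (intro set_integrable_phase continuous_intros) auto
  note int = this[unfolded set_integrable_def]
  have "kernel_form G_kernel x y N = (\<Sum>m\<le>N. \<Sum>n\<le>N. (LINT t|lborel. cnj (x m) * y n *
      (indicator {0..2*pi} t *\<^sub>R (complex_of_real (t / (2 * pi)) * (phase m t * cnj (phase n t))))))"
    unfolding kernel_form_def G_kernel_def set_lebesgue_integral_def integral_mult_right_zero
    by (simp only: mult_ac)
  also have "\<dots> = (LINT t|lborel. (\<Sum>m\<le>N. \<Sum>n\<le>N. cnj (x m) * y n *
      (indicator {0..2*pi} t *\<^sub>R (complex_of_real (t / (2 * pi)) * (phase m t * cnj (phase n t))))))"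
    using int by (simp only: Bochner_Integration.integral_sum Bochner_Integration.integrable_sum
        integrable_mult_right)
  also have "\<dots> = (LINT t:{0..2*pi}|lborel. \<Sum>m\<le>N. \<Sum>n\<le>N.
      cnj (x m) * y n * (complex_of_real (t / (2 * pi)) * (phase m t * cnj (phase n t))))"
    unfolding set_lebesgue_integral_def scaleR_sum_right mult_scaleR_right ..
  also have "\<dots> = (LINT t:{0..2*pi}|lborel. complex_of_real (t / (2 * pi)) *
     ((\<Sum>m\<le>N. cnj (x m) * phase m t) * cnj (\<Sum>n\<le>N. cnj (y n) * phase n t)))"
    by (simp add: sum_product sum_distrib_left mult_ac)
  finally show ?thesis .
qed

interpretation G_kernel: bounded_kernel G_kernel "2 * pi"
proof
  fix x y :: "nat \<Rightarrow> complex" and N :: nat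
  let ?I = "indicator {0..2*pi} :: real \<Rightarrow> real"
  let ?f = "\<lambda>t. ?I t *\<^sub>R (\<Sum>m\<le>N. cnj (x m) * phase m t)"
  let ?g = "\<lambda>t. ?I t *\<^sub>R (\<Sum>m\<le>N. cnj (y m) * phase m t)"
  have meas: "(\<lambda>t. ?I t *\<^sub>R (\<Sum>m\<le>N. cnj (z m) * phase m t)) \<in> borel_measurable lborel" for z
    using borel_measurable_continuous_onI[OF continuous_phase[of UNIV]] by measurable
  have int: "integrable lborel (\<lambda>t. (norm (?I t *\<^sub>R (\<Sum>m\<le>N. cnj (z m) * phase m t)))^2)" for z
  proof -
    have "set_integrable lborel {0..2*pi} (\<lambda>t. (norm (\<Sum>m\<le>N. cnj (z m) * phase m t))^2)"
      by (intro borel_integrable_atLeastAtMost' continuous_intros)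
    moreover have "(\<lambda>t. (norm (?I t *\<^sub>R (\<Sum>m\<le>N. cnj (z m) * phase m t)))^2)
        = (\<lambda>t. ?I t *\<^sub>R (norm (\<Sum>m\<le>N. cnj (z m) * phase m t))^2)"
      by (auto simp: indicator_def)
    ultimately show ?thesis by (simp only: set_integrable_def)
  qed
  let ?h = "\<lambda>t. complex_of_real (t / (2 * pi)) *
     ((\<Sum>m\<le>N. cnj (x m) * phase m t) * cnj (\<Sum>n\<le>N. cnj (y n) * phase n t))"
  have "set_integrable lborel {0..2*pi} ?h"
    by (intro set_integrable_phase continuous_intros) auto
  then have int_h: "integrable lborel (\<lambda>t. norm (?I t *\<^sub>R ?h t))"
    unfolding set_integrable_def by (rule integrable_norm)
  have "norm (kernel_form G_kernel x y N) \<le> (LINT t|lborel. norm (?I t *\<^sub>R ?h t))"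
    unfolding kernel_form_G_kernel set_lebesgue_integral_def by (rule integral_norm_bound)
  also have "\<dots> \<le> (LINT t|lborel. norm (?f t) * norm (?g t))"
  proof (rule integral_mono[OF int_h])
    show "integrable lborel (\<lambda>t. norm (?f t) * norm (?g t))"
      by (rule Cauchy_Schwarz_integral[OF meas meas int int])
    fix t :: real
    let ?a = "(\<Sum>m\<le>N. cnj (x m) * phase m t)" and ?b = "\<Sum>n\<le>N. cnj (y n) * phase n t"
    show "norm (?I t *\<^sub>R ?h t) \<le> norm (?f t) * norm (?g t)"
    proof (cases "t \<in> {0..2*pi}")
      case True
      \<comment> \<open>The weight is at most 1 on the interval. The constant \<open>2 * pi\<close>
        therefore comes solely from the two factors \<open>sqrt (2 * pi)\<close> of Parseval's
        identity.\<close>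
      then have "\<bar>t / (2 * pi)\<bar> * (norm ?a * norm ?b) \<le> 1 * (norm ?a * norm ?b)"
        by (intro mult_right_mono) (auto simp: divide_le_eq)
      then show ?thesis
        using True by (simp only: norm_mult norm_scaleR norm_of_real complex_mod_cnj indicator_simps)
    qed simp
  qed
  also have "\<dots> \<le> sqrt (LINT t|lborel. (norm (?f t))^2) * sqrt (LINT t|lborel. (norm (?g t))^2)"
    by (rule Cauchy_Schwarz_integral[OF meas meas int int])
  also have "\<dots> = sqrt (2 * pi) * sqrt (2 * pi)
      * sqrt (\<Sum>m\<le>N. (norm (x m))^2) * sqrt (\<Sum>n\<le>N. (norm (y n))^2)"
    unfolding Parseval_phase by (simp add: real_sqrt_mult mult_ac)
  finally show "norm (kernel_form G_kernel x y N)
      \<le> 2 * pi * sqrt (\<Sum>m\<le>N. (norm (x m))^2) * sqrt (\<Sum>n\<le>N. (norm (y n))^2)"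
    by simp
qed simp

section \<open>From the Toeplitz form to a bound for \<open>T_G\<close>\<close>

lemma G_term_eq_kernel_form:
  assumes f: "f \<in> L2" and g: "g \<in> L2"
  shows "G_term f g N = kernel_form G_kernel (\<lambda>m. ip (e_fun m) f) (\<lambda>n. ip (e_fun n) g) N"
proof -
  have phi: "phi_t t N = (\<lambda>x. \<Sum>n\<le>N. phase n t * e_fun n x)" for t
    by (simp add: phi_t_def phase_def)
  have "ip (phi_t t N) g = cnj (\<Sum>n\<le>N. cnj (ip (e_fun n) g) * phase n t)" for t
    using g unfolding phi
    by (simp add: ip_sum_left L2_cmult e_fun_L2 ip_cmult_left mult.commute[of "cnj (phase _ _)"])
  moreover have "ip f (phi_t t N) = (\<Sum>m\<le>N. cnj (ip (e_fun m) f) * phase m t)" for t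
    using f unfolding phi
    by (simp add: ip_sum_right L2_cmult e_fun_L2 ip_cmult_right ip_commute[of f "e_fun _"])
      (simp add: mult.commute)
  ultimately show ?thesis
    unfolding kernel_form_G_kernel G_term_def by (simp add: mult_ac)
qed

lemma summable_ip_e_fun:
  assumes "f \<in> L2" shows "summable (\<lambda>n. (norm (ip (e_fun n) f))^2)"
  by (rule bounded_imp_summable[where B = "(l2norm f)^2"]) (use Bessel_e_fun[OF assms] in auto)

lemma norm_G_term_le:
  assumes "f \<in> L2" "g \<in> L2"
  shows "norm (G_term f g N) \<le> 2 * pi * l2norm f * l2norm g"
  using G_kernel.kernel_form_le[OF Bessel_e_fun[OF assms(1)] Bessel_e_fun[OF assms(2)]]
  unfolding G_term_eq_kernel_form[OF assms] by simp

text \<open>The vector h has the coefficients \<open>c\<close> supplied by the representation of the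
  form. Continuity of the inner product identifies the common limit \<open>l\<close> with
  \<open>ip f h\<close>.\<close>

lemma G_term_representation:
  assumes g: "g \<in> L2"
  shows "\<exists>h\<in>L2. \<forall>f\<in>L2. G_term f g \<longlonglongrightarrow> ip f h"
proof -
  obtain c where c: "summable (\<lambda>m. (norm (c m))^2)"
    and repr: "\<And>x. summable (\<lambda>m. (norm (x m))^2) \<Longrightarrow>
      \<exists>l. kernel_form G_kernel x (\<lambda>n. ip (e_fun n) g) \<longlonglongrightarrow> l
        \<and> (\<lambda>M. \<Sum>m\<le>M. cnj (x m) * c m) \<longlonglongrightarrow> l"
    using G_kernel.kernel_form_representation[OF summable_ip_e_fun[OF g]] by blast
  obtain h where h: "h \<in> L2" "(\<lambda>N. l2norm (\<lambda>x. (\<Sum>m\<le>N. c m * e_fun m x) - h x)) \<longlonglongrightarrow> 0"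
    using Riesz_Fischer_e_fun[OF c] .
  have "G_term f g \<longlonglongrightarrow> ip f h" if f: "f \<in> L2" for f
  proof -
    obtain l where l: "kernel_form G_kernel (\<lambda>m. ip (e_fun m) f) (\<lambda>n. ip (e_fun n) g) \<longlonglongrightarrow> l"
      "(\<lambda>M. \<Sum>m\<le>M. cnj (ip (e_fun m) f) * c m) \<longlonglongrightarrow> l"
      using repr[OF summable_ip_e_fun[OF f]] by blast
    have "(\<lambda>N. ip f (\<lambda>x. \<Sum>m\<le>N. c m * e_fun m x)) \<longlonglongrightarrow> ip f h"
      by (intro tendsto_ip_right f h L2_sum L2_cmult e_fun_L2)
    also have "(\<lambda>N. ip f (\<lambda>x. \<Sum>m\<le>N. c m * e_fun m x))
        = (\<lambda>M. \<Sum>m\<le>M. cnj (ip (e_fun m) f) * c m)"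
      using f by (simp add: ip_sum_right L2_cmult e_fun_L2 ip_cmult_right
          ip_commute[of f "e_fun _"] mult.commute)
    finally have "l = ip f h" using l(2) LIMSEQ_unique by blast
    moreover have "G_term f g = kernel_form G_kernel (\<lambda>m. ip (e_fun m) f) (\<lambda>n. ip (e_fun n) g)"
      by (rule ext) (rule G_term_eq_kernel_form[OF f g])
    ultimately show ?thesis using l(1) by simp
  qed
  with h(1) show ?thesis by blast
qed

text \<open>Choosing a vector for each g yields an operator with the required limits, so the Hilbert
  choice in \<open>T_G\<close> picks one that has them.\<close>

lemma G_term_tendsto:
  assumes "f \<in> L2" "g \<in> L2"
  shows "G_term f g \<longlonglongrightarrow> ip f (T_G g)"
proof -
  obtain T where "\<forall>g\<in>L2. T g \<in> L2 \<and> (\<forall>f\<in>L2. G_term f g \<longlonglongrightarrow> ip f (T g))"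
    using G_term_representation by metis
  then have "\<exists>T. (\<forall>g\<in>L2. T g \<in> L2) \<and> (\<forall>f\<in>L2. \<forall>g\<in>L2. G_term f g \<longlonglongrightarrow> ip f (T g))"
    by blast
  then have "(\<forall>g\<in>L2. T_G g \<in> L2) \<and> (\<forall>f\<in>L2. \<forall>g\<in>L2. G_term f g \<longlonglongrightarrow> ip f (T_G g))"
    unfolding T_G_def by (rule someI_ex)
  then show ?thesis using assms by blast
qed

lemma norm_ip_T_G_le:
  assumes "f \<in> L2" "g \<in> L2"
  shows "norm (ip f (T_G g)) \<le> 2 * pi * l2norm f * l2norm g"
  using norm_G_term_le[OF assms]
  by (intro LIMSEQ_le_const2[OF tendsto_norm[OF G_term_tendsto[OF assms]]]) blast

lemma norm_tG_form_le:
  assumes "f \<in> L2" "g \<in> L2"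
  shows "norm (tG_form f g) \<le> 2 * pi * l2norm f * l2norm g"
proof -
  have "norm (ip (T_G f) g) \<le> 2 * pi * l2norm g * l2norm f"
    using norm_ip_T_G_le[OF assms(2,1)] by (simp add: ip_commute[of "T_G f" g])
  moreover have "norm (ip f (T_G g) + ip (T_G f) g) \<le> norm (ip f (T_G g)) + norm (ip (T_G f) g)"
    by (rule norm_triangle_ineq)
  ultimately show ?thesis
    using norm_ip_T_G_le[OF assms] by (simp add: tG_form_def norm_divide mult_ac)
qed

section \<open>Uniqueness of the operator values\<close>

text \<open>On a bounded interval the constant 1 is integrable and |f| \<le> 1 + |f|^2.\<close>

lemma L2_set_integrable:
  assumes "f \<in> L2" shows "set_integrable lborel {a..b} f"
proof -
  have [measurable]: "f \<in> borel_measurable borel" using assms by (simp add: L2_def)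
  show ?thesis
    unfolding set_integrable_def
  proof (rule Bochner_Integration.integrable_bound)
    have "set_integrable lborel {a..b} (\<lambda>x. 1 :: real)"
      by (intro borel_integrable_atLeastAtMost' continuous_intros)
    then show "integrable lborel (\<lambda>x. indicator {a..b} x + (norm (f x))^2)"
      using L2_integrable[OF assms] by (simp add: set_integrable_def)
    have "norm (f x) \<le> 1 + (norm (f x))^2" for x
      using sum_squares_bound[of 1 "norm (f x)"] norm_ge_zero[of "f x"]
      by (simp del: norm_ge_zero)
    then show "AE x in lborel. norm (indicator {a..b} x *\<^sub>R f x) \<le> norm (indicator {a..b} x + (norm (f x))^2)"
      by (auto simp: indicator_def)
  qed measurable
qed

lemma L2_interval_integrable:
  assumes "f \<in> L2" shows "interval_lebesgue_integrable lborel (ereal a) (ereal b) f"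
proof -
  have "set_integrable lborel {a<..<b} f" for a b
    by (rule set_integrable_subset[OF L2_set_integrable[OF assms, of a b]]) auto
  then show ?thesis by (simp add: interval_lebesgue_integrable_def)
qed

text \<open>After restriction to \<open>{-n..n}\<close> the function is integrable, and the sets
  over which its integral vanishes form a Dynkin system. It contains the half-lines, which are
  stable under intersection and generate the Borel sets.\<close>

lemma AE_zero_if_interval_integrals_zero:
  fixes f :: "real \<Rightarrow> complex"
  assumes f: "f \<in> L2"
    and zero: "\<And>a b. a \<le> b \<Longrightarrow> (LINT x:{a..b}|lborel. f x) = 0"
  shows "AE x in lborel. f x = 0"
proof -
  have local_zero: "AE x in lborel. indicator {-n..n} x *\<^sub>R f x = 0" for n :: real
  proof (rule sigma_finite_measure.density_zero[OF lborel.sigma_finite_measure_axioms])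
    let ?f = "\<lambda>x. indicator {-n..n} x *\<^sub>R f x"
    show int: "integrable lborel ?f"
      using L2_set_integrable[OF f] by (simp add: set_integrable_def)
    fix A :: "real set" assume "A \<in> sets lborel"
    then have A: "A \<in> sigma_sets UNIV (range (\<lambda>a. {..a}))"
      by (simp add: borel_eq_atMost)
    have "Int_stable (range (\<lambda>a::real. {..a}))" "range (\<lambda>a::real. {..a}) \<subseteq> Pow UNIV"
      by (auto simp: Int_stable_def)
    then show "(LINT x:A|lborel. ?f x) = 0"
      using A
    proof (induction rule: sigma_sets_induct_disjoint)
      case (basic A)
      then obtain a where A: "A = {..a}" by auto
      have "(LINT x:A|lborel. ?f x) = (LINT x:{-n..min a n}|lborel. f x)"
        unfolding set_lebesgue_integral_def A
        by (rule Bochner_Integration.integral_cong) (auto simp: indicator_def)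
      also have "\<dots> = 0"
        \<comment> \<open>If the end points are in the wrong order, the interval is empty and the
          integral vanishes trivially.\<close>
        using zero[of "-n" "min a n"] by (cases "-n \<le> min a n") (auto simp: set_lebesgue_integral_def)
      finally show ?case .
    next
      case empty
      show ?case by (simp add: set_lebesgue_integral_def)
    next
      case (compl A)
      then have [measurable]: "A \<in> sets borel" by (simp add: borel_eq_atMost)
      have "(LINT x:UNIV - A|lborel. ?f x) = (LINT x|lborel. ?f x - indicator A x *\<^sub>R ?f x)"
        unfolding set_lebesgue_integral_def
        by (rule Bochner_Integration.integral_cong) (auto simp: indicator_def)
      also have "\<dots> = (LINT x|lborel. ?f x) - (LINT x:A|lborel. ?f x)"
        unfolding set_lebesgue_integral_def
        by (rule Bochner_Integration.integral_diff[OF int integrable_mult_indicator[OF _ int]]) simp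
      also have "(LINT x|lborel. ?f x) = 0"
        using zero[of "-n" n] by (cases "-n \<le> n") (auto simp: set_lebesgue_integral_def)
      finally show ?case using compl by simp
    next
      case (union A)
      then have [measurable]: "A i \<in> sets borel" for i by (auto simp: borel_eq_atMost)
      have "(LINT x:(\<Union>i. A i)|lborel. ?f x) = (\<Sum>i. LINT x:A i|lborel. ?f x)"
      proof (rule lebesgue_integral_countable_add)
        show "set_integrable lborel (\<Union>i. A i) ?f"
          unfolding set_integrable_def by (rule integrable_mult_indicator[OF _ int]) simp
        show "A i \<inter> A j = {}" if "i \<noteq> j" for i j
          using union(1) that by (auto simp: disjoint_family_on_def)
      qed auto
      then show ?case using union by simp
    qed
  qed
  have "AE x in lborel. \<forall>n::nat. indicator {-real n..real n} x *\<^sub>R f x = 0"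
    unfolding AE_all_countable using local_zero by blast
  then show ?thesis
  proof eventually_elim
    case (elim x)
    obtain n :: nat where "\<bar>x\<bar> \<le> real n" using real_arch_simple by blast
    with elim[rule_format, of n] show ?case by (simp add: indicator_def abs_le_iff)
  qed
qed

text \<open>The primitive is continuous, so the set where it equals c is closed. Having full
  measure, it is the whole line, and differences of the primitive give vanishing interval
  integrals.\<close>

lemma AE_zero_if_indefinite_integral_const:
  assumes f: "f \<in> L2"
    and const: "AE x in lborel. (LBINT y=0..ereal x. f y) = c"
  shows "AE x in lborel. f x = 0"
proof -
  let ?F = "\<lambda>x. LBINT y=0..ereal x. f y"
  have diff: "?F b - ?F a = (LINT x:{a..b}|lborel. f x)" if "a \<le> b" for a b
  proof -
    have "(LBINT y=ereal 0..ereal a. f y) + (LBINT y=ereal a..ereal b. f y) = (LBINT y=ereal 0..ereal b. f y)"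
      by (rule interval_integral_sum) (simp add: min_def max_def L2_interval_integrable[OF f])
    then show ?thesis
      using interval_integral_Icc[OF that, of f] by (simp add: algebra_simps zero_ereal_def)
  qed
  have cont: "continuous_on UNIV ?F"
  proof -
    \<comment> \<open>Open intervals are used because continuity passes to unions of open
      sets.\<close>
    have "continuous_on {-n<..<n} ?F" for n :: real
    proof -
      have int: "f integrable_on {-n..n}"
        using L2_set_integrable[OF f] by (rule set_borel_integral_eq_integral)
      have "continuous_on {-n..n} (\<lambda>x. ?F (-n) + integral {-n..x} f)"
        by (intro continuous_intros indefinite_integral_continuous_1 int)
      moreover have "?F x = ?F (-n) + integral {-n..x} f" if "x \<in> {-n..n}" for x
        using diff[of "-n" x] that set_borel_integral_eq_integral(2)[OF L2_set_integrable[OF f, of "-n" x]]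
        by (simp add: algebra_simps)
      ultimately have "continuous_on {-n..n} ?F"
        using continuous_on_cong[OF refl] by (metis (no_types, lifting))
      then show ?thesis by (rule continuous_on_subset) auto
    qed
    then have "continuous_on (\<Union>n. {-real n<..<real n}) ?F"
      by (intro continuous_on_open_UN) auto
    moreover have "(\<Union>n. {-real n<..<real n}) = UNIV"
    proof (intro UNIV_eq_I[symmetric])
      fix x :: real
      obtain n :: nat where "\<bar>x\<bar> < real n" using reals_Archimedean2 by blast
      then show "x \<in> (\<Union>n. {-real n<..<real n})" by (intro UN_I[of n]) auto
    qed
    ultimately show ?thesis by simp
  qed
  have "AE x in lebesgue. x \<in> {x. ?F x = c}"
    using AE_completion[OF const] by simp
  moreover have "closed {x. ?F x = c}"
    using cont by (intro closed_Collect_eq) auto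
  ultimately have "?F x = c" for x
    using mem_closed_if_AE_lebesgue[of "{x. ?F x = c}" x] by simp
  then show ?thesis
    using diff by (intro AE_zero_if_interval_integrals_zero[OF f]) simp
qed

text \<open>Subtracting the two integral representations leaves a primitive of \<open>g - g'\<close>
  that is a.e. constant.\<close>

lemma p_rel_unique:
  assumes "p_rel f g" "p_rel f' g'" and eq: "AE x in lborel. f x = f' x"
  shows "AE x in lborel. g x = g' x"
proof -
  obtain c where g: "g \<in> L2" and c: "AE x in lborel. f x = c + \<i> * (LBINT y=0..ereal x. g y)"
    using assms(1) by (auto simp: p_rel_def)
  obtain c' where g': "g' \<in> L2" and c': "AE x in lborel. f' x = c' + \<i> * (LBINT y=0..ereal x. g' y)"
    using assms(2) by (auto simp: p_rel_def)
  have "AE x in lborel. (LBINT y=0..ereal x. g y - g' y) = \<i> * (c - c')"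
    using eq c c'
  proof eventually_elim
    case (elim x)
    have "(LBINT y=ereal 0..ereal x. g y - g' y) = (LBINT y=ereal 0..ereal x. g y) - (LBINT y=ereal 0..ereal x. g' y)"
      by (intro interval_lebesgue_integral_diff L2_interval_integrable g g')
    moreover have "(LBINT y=0..ereal x. g y) - (LBINT y=0..ereal x. g' y) = \<i> * (c - c')"
    proof -
      let ?X = "(LBINT y=0..ereal x. g y) - (LBINT y=0..ereal x. g' y)"
      have X: "\<i> * ?X = c' - c"
        using elim by (simp add: algebra_simps)
      have "?X = - (\<i> * (\<i> * ?X))" by simp
      also have "\<dots> = \<i> * (c - c')" unfolding X by (simp add: algebra_simps)
      finally show ?thesis .
    qed
    ultimately show ?case by (simp add: zero_ereal_def)
  qed
  then have "AE x in lborel. g x - g' x = 0"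
    by (rule AE_zero_if_indefinite_integral_const[OF L2_diff[OF g g']])
  then show ?thesis by simp
qed

lemma t_rel_unique:
  assumes "t_rel f h" "t_rel f' h'" "AE x in lborel. f x = f' x"
  shows "AE x in lborel. h x = h' x"
proof -
  obtain g g' where g: "p_rel f g" "AE x in lborel. h x = g x / complex_of_real x"
      and g': "p_rel f' g'" "AE x in lborel. h' x = g' x / complex_of_real x"
    using assms(1,2) by (auto simp: t_rel_def qinv_rel_def)
  show ?thesis
    using p_rel_unique[OF g(1) g'(1) assms(3)] g(2) g'(2) by eventually_elim simp
qed

text \<open>Every intermediate power is determined only up to a null set, so the induction must let
  the starting functions differ on one.\<close>

lemma pow_rel_t_rel_unique:
  assumes "pow_rel t_rel n f h" "pow_rel t_rel n f' h'" "AE x in lborel. f x = f' x"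
  shows "AE x in lborel. h x = h' x"
  using assms
proof (induction n arbitrary: f f')
  case 0
  then have "AE x in lborel. h x = f x" "AE x in lborel. h' x = f' x" by simp_all
  with 0(3) show ?case by eventually_elim simp
next
  case (Suc n)
  then obtain g g' where "t_rel f g" "pow_rel t_rel n g h" "t_rel f' g'" "pow_rel t_rel n g' h'"
    by auto
  with Suc.IH Suc.prems(3) t_rel_unique show ?case by blast
qed

lemma pow_rel_L2: "pow_rel R n f h \<Longrightarrow> h \<in> L2"
  by (induction n arbitrary: f) auto

lemma l2norm_cong_AE:
  assumes "f \<in> L2" "g \<in> L2" "AE x in lborel. f x = g x"
  shows "l2norm f = l2norm g"
proof -
  have "(LINT x|lborel. (norm (f x))^2) = (LINT x|lborel. (norm (g x))^2)"
    using assms(3) L2_integrable[OF assms(1)] L2_integrable[OF assms(2)]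
    by (intro integral_cong_AE) auto
  then show ?thesis by (simp add: l2norm_def)
qed

text \<open>The two choices of powers agree a.e. simultaneously for all n, so both partial sums
  define the same \<open>L2\<close>-limit. This gives access to the arbitrary representative
  \<open>S_app\<close>.\<close>

lemma S_rel_unique:
  assumes "S_rel f g" "S_rel f g'"
  shows "AE x in lborel. g x = g' x"
proof -
  let ?c = "\<lambda>n. complex_of_real ((-1)^n / real (2 * n + 1))"
  obtain u where g: "g \<in> L2" and u: "\<And>n. pow_rel t_rel (2 * n + 1) f (u n)"
    and lim: "(\<lambda>N. l2norm (\<lambda>x. (\<Sum>n\<le>N. ?c n * u n x) + g x)) \<longlonglongrightarrow> 0"
    using assms(1) unfolding S_rel_def S_gen_rel_def by blast
  obtain u' where g': "g' \<in> L2" and u': "\<And>n. pow_rel t_rel (2 * n + 1) f (u' n)"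
    and lim': "(\<lambda>N. l2norm (\<lambda>x. (\<Sum>n\<le>N. ?c n * u' n x) + g' x)) \<longlonglongrightarrow> 0"
    using assms(2) unfolding S_rel_def S_gen_rel_def by blast
  have "AE x in lborel. u n x = u' n x" for n
    by (rule pow_rel_t_rel_unique[OF u u']) simp
  then have AE_u: "AE x in lborel. \<forall>n. u n x = u' n x"
    by (simp add: AE_all_countable)
  have le: "l2norm (\<lambda>x. g x - g' x) \<le> l2norm (\<lambda>x. (\<Sum>n\<le>N. ?c n * u n x) + g x)
      + l2norm (\<lambda>x. (\<Sum>n\<le>N. ?c n * u' n x) + g' x)" for N
  proof -
    let ?a = "\<lambda>x. (\<Sum>n\<le>N. ?c n * u n x) + g x" and ?b = "\<lambda>x. (\<Sum>n\<le>N. ?c n * u' n x) + g' x"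
    have a: "?a \<in> L2" by (intro L2_add L2_sum L2_cmult pow_rel_L2[OF u] g)
    have b: "?b \<in> L2" by (intro L2_add L2_sum L2_cmult pow_rel_L2[OF u'] g')
    have "AE x in lborel. g x - g' x = ?a x - ?b x"
      using AE_u by eventually_elim simp
    then have "l2norm (\<lambda>x. g x - g' x) = l2norm (\<lambda>x. ?a x - ?b x)"
      by (intro l2norm_cong_AE L2_diff a b g g')
    then show ?thesis using l2norm_diff_le[OF a b] by simp
  qed
  have "l2norm (\<lambda>x. g x - g' x) \<le> 0 + 0"
    using le by (intro LIMSEQ_le_const[OF tendsto_add[OF lim lim']]) blast
  then have "AE x in lborel. g x - g' x = 0"
    by (intro l2norm_eq_0_AE L2_diff g g') (simp add: order_antisym)
  then show ?thesis by simp
qed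

section \<open>Gaussians are eigenvectors of \<open>S\<close>\<close>

definition gauss :: "real \<Rightarrow> real \<Rightarrow> complex" where
  "gauss a x = complex_of_real (exp (- a * x^2 / 2))"

lemma gauss_L2: "0 < a \<Longrightarrow> gauss a \<in> L2"
  using power_gaussian_L2[of a 0] by (simp add: gauss_def[abs_def])

text \<open>The complex factor c is carried along because iterating t multiplies the Gaussian by
  further constants.\<close>

lemma p_rel_gauss:
  assumes "0 < a"
  shows "p_rel (\<lambda>x. c * gauss a x) (\<lambda>x. c * \<i> * complex_of_real (a * x) * gauss a x)"
  unfolding p_rel_def
proof (intro conjI exI AE_I2)
  show "(\<lambda>x. c * gauss a x) \<in> L2"
    by (intro L2_cmult gauss_L2 assms)
  have "(\<lambda>x. (c * \<i> * complex_of_real a) * complex_of_real (x^1 * exp (- a * x^2 / 2))) \<in> L2"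
    by (intro L2_cmult power_gaussian_L2 assms)
  then show "(\<lambda>x. c * \<i> * complex_of_real (a * x) * gauss a x) \<in> L2"
    by (simp add: gauss_def mult_ac)
  fix x :: real
  have deriv: "(gauss a has_vector_derivative - complex_of_real (a * y) * gauss a y) (at y within A)" for y A
    unfolding gauss_def of_real_mult[symmetric] of_real_minus[symmetric]
    by (rule bounded_linear.has_vector_derivative[OF bounded_linear_of_real],
        unfold has_real_derivative_iff_has_vector_derivative[symmetric])
      (auto intro!: derivative_eq_intros)
  have int_eq: "(LBINT y=ereal 0..ereal x. c * \<i> * complex_of_real (a * y) * gauss a y)
      = - (c * \<i>) * gauss a x - - (c * \<i>) * gauss a 0"
  proof (rule interval_integral_FTC_finite)
    show "continuous_on {min 0 x..max 0 x} (\<lambda>y. c * \<i> * complex_of_real (a * y) * gauss a y)"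
      unfolding gauss_def by (intro continuous_intros) auto
    show "((\<lambda>y. - (c * \<i>) * gauss a y) has_vector_derivative c * \<i> * complex_of_real (a * y) * gauss a y)
        (at y within {min 0 x..max 0 x})" for y
      using has_vector_derivative_mult_right[OF deriv, of "- (c * \<i>)"] by (simp add: mult.assoc)
  qed
  \<comment> \<open>The constant of integration in \<open>p_rel\<close> is the value at 0, here c
    because \<open>gauss a 0\<close> is 1.\<close>
  show "c * gauss a x = c + \<i> * (LBINT y=0..ereal x. c * \<i> * complex_of_real (a * y) * gauss a y)"
    unfolding zero_ereal_def int_eq by (simp add: gauss_def algebra_simps)
qed

lemma t_rel_gauss:
  assumes "0 < a"
  shows "t_rel (\<lambda>x. c * gauss a x) (\<lambda>x. c * (\<i> * complex_of_real a) * gauss a x)"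
  unfolding t_rel_def
proof (intro exI conjI)
  show p: "p_rel (\<lambda>x. c * gauss a x) (\<lambda>x. c * \<i> * complex_of_real (a * x) * gauss a x)"
    by (rule p_rel_gauss[OF assms])
  \<comment> \<open>Division by x cancels the factor produced by differentiation everywhere except
    at the null set \<open>{0}\<close>.\<close>
  have "AE x in lborel. x \<noteq> (0::real)" by (rule AE_lborel_singleton)
  then have "AE x in lborel. c * (\<i> * complex_of_real a) * gauss a x
      = c * \<i> * complex_of_real (a * x) * gauss a x / complex_of_real x"
    by eventually_elim simp
  then show "qinv_rel (\<lambda>x. c * \<i> * complex_of_real (a * x) * gauss a x)
      (\<lambda>x. c * (\<i> * complex_of_real a) * gauss a x)"
    using p L2_cmult[OF gauss_L2[OF assms]] unfolding qinv_rel_def p_rel_def by blast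
qed

lemma pow_rel_gauss:
  assumes "0 < a"
  shows "pow_rel t_rel n (\<lambda>x. c * gauss a x) (\<lambda>x. c * (\<i> * complex_of_real a)^n * gauss a x)"
proof (induction n arbitrary: c)
  case 0
  then show ?case using L2_cmult[OF gauss_L2[OF assms]] by simp
next
  case (Suc n)
  then show ?case
    using t_rel_gauss[OF assms, of c] Suc[of "c * (\<i> * complex_of_real a)"] by (auto simp: mult_ac)
qed

text \<open>With \<open>a = (x - 1) / (x + 1)\<close> the eigenvalue \<open>- \<i> artanh a\<close> becomes \<open>- \<i> ln x / 2\<close>.\<close>

lemma S_rel_gauss:
  assumes "1 < x" and a: "a = (x - 1) / (x + 1)"
  shows "S_rel (gauss a) (\<lambda>y. - \<i> * complex_of_real (ln x / 2) * gauss a y)"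
  unfolding S_rel_def S_gen_rel_def
proof (intro conjI exI allI)
  have a0: "0 < a" using assms by simp
  note L2 = gauss_L2[OF a0]
  show "gauss a \<in> L2_even" using L2 by (simp add: L2_even_def gauss_def)
  show "(\<lambda>y. - \<i> * complex_of_real (ln x / 2) * gauss a y) \<in> L2" by (intro L2_cmult L2)
  show "pow_rel t_rel (2 * n + 1) (gauss a) (\<lambda>y. (\<i> * complex_of_real a)^(2 * n + 1) * gauss a y)" for n
    using pow_rel_gauss[OF a0, of "2 * n + 1" 1] by simp
  \<comment> \<open>The alternating sign cancels against the even power of \<i>, turning the arctan
    series into the artanh series.\<close>
  have coeff_eq: "complex_of_real ((-1)^n / real (2 * n + 1)) * (\<i> * complex_of_real a)^(2 * n + 1)
      = \<i> * complex_of_real (a^(2 * n + 1) / real (2 * n + 1))" for n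
    by (simp add: power_mult_distrib power_mult mult.assoc[symmetric] power_mult_distrib[symmetric])
  have "(\<lambda>n. 2 * a^(2 * n + 1) / real (2 * n + 1)) sums ln x"
    using ln_series_quadratic[of x] assms by simp
  then have "(\<lambda>n. a^(2 * n + 1) / real (2 * n + 1)) sums (ln x / 2)"
    by (rule sums_divide[where c = 2, THEN sums_cong[THEN iffD1, rotated]]) (simp add: field_simps)
  then have lim: "(\<lambda>N. (\<Sum>n\<le>N. a^(2 * n + 1) / real (2 * n + 1))) \<longlonglongrightarrow> ln x / 2"
    by (simp add: sums_def_le)
  have "l2norm (\<lambda>y. (\<Sum>n\<le>N. complex_of_real ((-1)^n / real (2 * n + 1)) *
        ((\<i> * complex_of_real a)^(2 * n + 1) * gauss a y)) + - \<i> * complex_of_real (ln x / 2) * gauss a y)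
      = \<bar>(\<Sum>n\<le>N. a^(2 * n + 1) / real (2 * n + 1)) - ln x / 2\<bar> * l2norm (gauss a)" for N
  proof -
    have "(\<Sum>n\<le>N. complex_of_real ((-1)^n / real (2 * n + 1)) *
        ((\<i> * complex_of_real a)^(2 * n + 1) * gauss a y)) + - \<i> * complex_of_real (ln x / 2) * gauss a y
        = \<i> * complex_of_real ((\<Sum>n\<le>N. a^(2 * n + 1) / real (2 * n + 1)) - ln x / 2) * gauss a y" for y
      unfolding mult.assoc[symmetric] coeff_eq
      by (simp only: of_real_diff of_real_sum sum_distrib_left sum_distrib_right algebra_simps) simp
    then show ?thesis
      by (simp only: l2norm_def norm_mult norm_ii norm_of_real power_mult_distrib
          integral_mult_right_zero real_sqrt_mult real_sqrt_abs mult_1 abs_idempotent abs_one power_one)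
  qed
  moreover have "(\<lambda>N. \<bar>(\<Sum>n\<le>N. a^(2 * n + 1) / real (2 * n + 1)) - ln x / 2\<bar> * l2norm (gauss a)) \<longlonglongrightarrow> 0"
    using lim by (intro tendsto_mult_left_zero tendsto_rabs_zero) (simp add: LIM_zero)
  ultimately show "(\<lambda>N. l2norm (\<lambda>y. (\<Sum>n\<le>N. complex_of_real ((-1)^n / real (2 * n + 1)) *
        ((\<i> * complex_of_real a)^(2 * n + 1) * gauss a y)) + - \<i> * complex_of_real (ln x / 2) * gauss a y))
      \<longlonglongrightarrow> 0"
    by (simp only:)
qed

text \<open>\<open>S_app\<close> is determined only a.e., and an inner product does not see the
  choice of representative.\<close>

lemma ip_S_app_gauss:
  assumes "1 < x" and a: "a = (x - 1) / (x + 1)" and f: "f \<in> L2"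
  shows "ip f (S_app (gauss a)) = - \<i> * complex_of_real (ln x / 2) * ip f (gauss a)"
proof -
  have rel: "S_rel (gauss a) (\<lambda>y. - \<i> * complex_of_real (ln x / 2) * gauss a y)"
    by (rule S_rel_gauss[OF assms(1,2)])
  then have app: "S_rel (gauss a) (S_app (gauss a))"
    unfolding S_app_def by (rule someI[of "S_rel (gauss a)"])
  have "ip f (S_app (gauss a)) = ip f (\<lambda>y. - \<i> * complex_of_real (ln x / 2) * gauss a y)"
    using S_rel_unique[OF app rel] app rel f
    by (intro ip_cong_AE_right) (auto simp: S_rel_def S_gen_rel_def)
  then show ?thesis by (simp only: ip_cmult_right)
qed

section \<open>Evaluation of \<open>t_form\<close> on Gaussians and its unboundedness\<close>

lemma even_part_gauss: "even_part (gauss a) = gauss a"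
  by (simp add: even_part_def gauss_def fun_eq_iff)

lemma odd_part_gauss: "odd_part (gauss a) = (\<lambda>x. 0)"
  by (simp add: odd_part_def gauss_def)

text \<open>Gaussians are even, so this is what \<open>form_dom\<close> demands of their odd
  part.\<close>

lemma zero_in_Sstar_dom: "(\<lambda>x. 0) \<in> Sstar_dom"
proof -
  have "tadj_rel (\<lambda>x. 0) (\<lambda>x. 0)"
    by (simp add: tadj_rel_def L2_zero ip_def)
  then have pow: "pow_rel tadj_rel n (\<lambda>x. 0) (\<lambda>x. 0)" for n
    by (induction n) (auto simp: L2_zero)
  have "S_gen_rel tadj_rel L2_odd (\<lambda>x. 0) (\<lambda>x. 0)"
    unfolding S_gen_rel_def
    by (intro conjI exI[of _ "\<lambda>n x. 0"] allI pow) (simp_all add: L2_odd_def L2_zero l2norm_def)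
  then show ?thesis by (auto simp: Sstar_dom_def Sstar_rel_def)
qed

lemma gauss_form_dom:
  assumes "1 < x" and a: "a = (x - 1) / (x + 1)"
  shows "gauss a \<in> form_dom"
  using gauss_L2[of a] S_rel_gauss[OF assms] zero_in_Sstar_dom assms
  by (auto simp: form_dom_def even_part_gauss odd_part_gauss S_dom_def)

text \<open>The eigenvalue is imaginary and is conjugated in the left argument, which turns the
  symmetrised sum into a difference of logarithms.\<close>

lemma t_form_gauss:
  assumes x: "1 < x" and a: "a = (x - 1) / (x + 1)"
    and y: "1 < y" and b: "b = (y - 1) / (y + 1)"
  shows "t_form (gauss b) (gauss a)
    = - \<i> * complex_of_real ((ln x - ln y) / 4) * ip (gauss b) (gauss a)"
proof -
  have L2: "gauss a \<in> L2" "gauss b \<in> L2" using assms by (auto intro!: gauss_L2)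
  have "ip (S_app (gauss b)) (gauss a) = \<i> * complex_of_real (ln y / 2) * ip (gauss b) (gauss a)"
    by (subst (1 2) ip_commute) (simp add: ip_S_app_gauss[OF y b L2(1)])
  moreover have "ip (\<lambda>x. 0) h = 0" "ip h (\<lambda>x. 0) = 0" for h
    by (simp_all add: ip_def)
  ultimately show ?thesis
    by (simp add: t_form_def even_part_gauss odd_part_gauss ip_S_app_gauss[OF x a L2(2)] field_simps)
qed

text \<open>For parameters up to 1 each Gaussian dominates \<open>gauss 1\<close> pointwise, which
  bounds the overlap from below uniformly.\<close>

lemma ip_gauss_ge:
  assumes "0 < a" "a \<le> 1" "0 < b" "b \<le> 1"
  shows "(l2norm (gauss 1))^2 \<le> norm (ip (gauss b) (gauss a))"
proof -
  have eq: "cnj (gauss b x) * gauss a x = complex_of_real (exp (- b * x^2 / 2) * exp (- a * x^2 / 2))" for x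
    by (simp add: gauss_def)
  have int: "integrable lborel (\<lambda>x. exp (- b * x^2 / 2) * exp (- a * x^2 / 2))"
    if "0 < a" "0 < b" for a b :: real
    using integrable_ip[OF gauss_L2[OF that(2)] gauss_L2[OF that(1)]]
    by (simp only: gauss_def complex_cnj_complex_of_real of_real_mult[symmetric] complex_of_real_integrable_eq)
  have "(l2norm (gauss 1))^2 = (LINT x|lborel. exp (- 1 * x^2 / 2) * exp (- 1 * x^2 / 2))"
    unfolding l2norm_power2 by (simp add: gauss_def power2_eq_square)
  also have "\<dots> \<le> (LINT x|lborel. exp (- b * x^2 / 2) * exp (- a * x^2 / 2))"
    using assms by (intro integral_mono int mult_mono) (auto intro!: mult_left_le_one_le)
  also have "\<dots> \<le> norm (ip (gauss b) (gauss a))"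
    unfolding ip_def eq integral_complex_of_real norm_of_real by simp
  finally show ?thesis .
qed

lemma l2norm_gauss_antimono:
  assumes "0 < a" "a \<le> b" shows "l2norm (gauss b) \<le> l2norm (gauss a)"
  unfolding l2norm_def
proof (intro real_sqrt_le_mono integral_mono L2_integrable gauss_L2 power_mono)
  show "norm (gauss b x) \<le> norm (gauss a x)" for x
    using assms by (simp add: gauss_def mult_right_mono)
qed (use assms in auto)

lemma l2norm_gauss_pos:
  assumes "0 < a" shows "0 < l2norm (gauss a)"
proof (rule ccontr)
  assume "\<not> 0 < l2norm (gauss a)"
  then have "l2norm (gauss a) = 0" using l2norm_nonneg[of "gauss a"] by linarith
  then have "AE x in (lborel :: real measure). False"
    using l2norm_eq_0_AE[OF gauss_L2[OF assms]] by (simp add: gauss_def)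
  then show False
    using ae_filter_eq_bot_iff[of "lborel :: real measure"] by (simp add: trivial_limit_def)
qed

lemma t_form_unbounded:
  "\<not> (\<exists>C. \<forall>\<psi>\<in>form_dom. \<forall>\<phi>\<in>form_dom. norm (t_form \<psi> \<phi>) \<le> C * l2norm \<psi> * l2norm \<phi>)"
proof
  assume "\<exists>C. \<forall>\<psi>\<in>form_dom. \<forall>\<phi>\<in>form_dom. norm (t_form \<psi> \<phi>) \<le> C * l2norm \<psi> * l2norm \<phi>"
  then obtain C where C: "\<And>\<psi> \<phi>. \<psi> \<in> form_dom \<Longrightarrow> \<phi> \<in> form_dom \<Longrightarrow>
      norm (t_form \<psi> \<phi>) \<le> C * l2norm \<psi> * l2norm \<phi>" by blast
  define D where "D = (l2norm (gauss 1))^2"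
  define M where "M = l2norm (gauss (1/2))"
  \<comment> \<open>Chosen so that \<open>r / 4 * D\<close> exceeds
    \<open>\<bar>C\<bar> * M * M\<close> by exactly 1. Here D bounds the overlap from below and M
    bounds both norms from above; the absolute value allows for negative C.\<close>
  define r where "r = 4 * (\<bar>C\<bar> * M * M + 1) / D"
  \<comment> \<open>The parameter 1/2 corresponds to y = 3, so this makes the difference of
    logarithms equal to r.\<close>
  define x where "x = 3 * exp r"
  define a where "a = (x - 1) / (x + 1)"
  have D: "0 < D" using l2norm_gauss_pos[of 1] by (simp add: D_def)
  have M: "0 < M" unfolding M_def by (rule l2norm_gauss_pos) simp
  have r: "0 < r" using D M by (simp add: r_def add_nonneg_pos)
  then have x: "3 < x" by (simp add: x_def)
  have a: "1/2 \<le> a" "a \<le> 1" using x by (simp_all add: a_def field_simps)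
  have b: "(1/2 :: real) = (3 - 1) / (3 + 1)" by simp
  have ln: "ln x - ln 3 = r" by (simp add: x_def ln_mult)
  have "r / 4 * D \<le> r / 4 * norm (ip (gauss (1/2)) (gauss a))"
    unfolding D_def using a r by (intro mult_left_mono ip_gauss_ge) auto
  also have "\<dots> = norm (t_form (gauss (1/2)) (gauss a))"
    using t_form_gauss[OF _ a_def _ b] x r unfolding ln
    by (simp add: norm_mult norm_divide)
  also have "\<dots> \<le> C * M * l2norm (gauss a)"
    unfolding M_def using x by (intro C gauss_form_dom[OF _ b] gauss_form_dom[OF _ a_def]) auto
  also have "\<dots> \<le> \<bar>C\<bar> * M * M"
    using M a by (intro mult_mono) (auto simp: M_def intro!: l2norm_gauss_antimono mult_right_mono)
  finally show False using D by (simp add: r_def)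
qed

theorem theorem6p6:
  shows "(\<exists>\<psi>\<in>form_dom. \<exists>\<phi>\<in>form_dom. t_form \<psi> \<phi> \<noteq> tG_form \<psi> \<phi>)
       \<and> (\<exists>C. \<forall>\<psi>\<in>L2. \<forall>\<phi>\<in>L2. norm (tG_form \<psi> \<phi>) \<le> C * l2norm \<psi> * l2norm \<phi>)
       \<and> \<not> (\<exists>C. \<forall>\<psi>\<in>form_dom. \<forall>\<phi>\<in>form_dom. norm (t_form \<psi> \<phi>) \<le> C * l2norm \<psi> * l2norm \<phi>)"
proof -
  have tG: "norm (tG_form \<psi> \<phi>) \<le> 2 * pi * l2norm \<psi> * l2norm \<phi>" if "\<psi> \<in> L2" "\<phi> \<in> L2" for \<psi> \<phi>
    using that by (rule norm_tG_form_le)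
  have "\<exists>\<psi>\<in>form_dom. \<exists>\<phi>\<in>form_dom. t_form \<psi> \<phi> \<noteq> tG_form \<psi> \<phi>"
  proof (rule ccontr)
    assume "\<not> ?thesis"
    then have "norm (t_form \<psi> \<phi>) \<le> 2 * pi * l2norm \<psi> * l2norm \<phi>"
      if "\<psi> \<in> form_dom" "\<phi> \<in> form_dom" for \<psi> \<phi>
      using tG[of \<psi> \<phi>] that by (simp add: form_dom_def)
    then show False using t_form_unbounded by blast
  qed
  with tG t_form_unbounded show ?thesis by blast
qed

end
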